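(* Let $\mathbb{G}$ be a stratified group with $N$ being the dimension of the first stratum, and let $\alpha\in\mathbb{R}$. Then for any $f\in C_{0}^{\infty}(\mathbb{G}\setminus\{x'=0\})$ and all $1<p<\infty$, we have $$\frac{|N-\alpha p|}{p}\left\|\frac{f}{|x'|^{\alpha}}\right\|_{L^{p}(\mathbb{G})}\leq \left\|\frac{x'\cdot \nabla_{H}f}{|x'|^{\alpha}}\right\|_{L^{p}(\mathbb{G})},$$ where $|\cdot|$ is the Euclidean norm on $\mathbb{R}^{N}$. If $N\neq\alpha p$, then the constant $\frac{|N-\alpha p|}{p}$ is sharp, i.e. it cannot be replaced by any larger constant in the inequality valid for all $f\in C_{0}^{\infty}(\mathbb{G}\setminus\{x'=0\})$.
   Context: A Lie group $\mathbb{G}=(\mathbb{R}^{n},\circ)$ is called a stratified group (homogeneous Carnot group) if: (i) for some natural numbers $N=N_1,N_2,\ldots,N_r$ with $N+N_{2}+\ldots+N_{r}=n$, writing $\mathbb{R}^{n}=\mathbb{R}^{N}\times\mathbb{R}^{N_2}\times\ldots\times\mathbb{R}^{N_{r}}$ and $x=(x',x^{(2)},\ldots,x^{(r)})$ with $x'\in\mathbb{R}^N$, $x^{(k)}\in\mathbb{R}^{N_k}$, the dilation $\delta_{\lambda}(x)=(\lambda x',\lambda^{2}x^{(2)},\ldots,\lambda^{r}x^{(r)})$ is an automorphism of $\mathbb{G}$ for every $\lambda>0$; (ii) if $X_{1},\ldots,X_{N}$ are the left invariant vector fields on $\mathbb{G}$ with $X_{k}(0)=\frac{\partial}{\partial x_{k}}|_{0}$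 for $k=1,\ldots,N$, then ${\rm rank}({\rm Lie}\{X_{1},\ldots,X_{N}\})=n$ at every $x\in\mathbb{R}^{n}$, i.e. the iterated commutators of $X_1,\ldots,X_N$ span the Lie algebra of $\mathbb{G}$. The number $N$ is the dimension of the first stratum and $x'$ denotes the variables of the first stratum. The horizontal gradient is $\nabla_{H}=(X_{1},\ldots,X_{N})$, $x'\cdot\nabla_H f=\sum_{k=1}^N x'_k X_k f$, and $|x'|=\sqrt{x_1'^2+\ldots+x_N'^2}$. The set $\{x'=0\}$ is $\{x\in\mathbb{G}: x'=0\}$. $L^p(\mathbb{G})$ is taken with respect to Lebesgue measure $dx$ on $\mathbb{R}^n$, which is the Haar measure of $\mathbb{G}$. $C_0^\infty(\Omega)$ denotes smooth complex-valued functions compactly supported in the open set $\Omega$. *)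

theory Defs
  imports "HOL-Analysis.Analysis" "HOL-Algebra.Group"
begin

section \<open>Smooth functions and \<open>L\<^sup>p\<close> norms\<close>

text \<open>\<open>Ck_on k f S\<close> is meant for open \<open>S\<close>.\<close>

fun Ck_on :: "nat \<Rightarrow> ('a::euclidean_space \<Rightarrow> 'b::real_normed_vector) \<Rightarrow> 'a set \<Rightarrow> bool" where
  "Ck_on 0 f S \<longleftrightarrow> continuous_on S f"
| "Ck_on (Suc k) f S \<longleftrightarrow>
     (\<forall>x\<in>S. f differentiable (at x)) \<and> (\<forall>v. Ck_on k (\<lambda>x. frechet_derivative f (at x) v) S)"

definition smooth_on :: "'a::euclidean_space set \<Rightarrow> ('a \<Rightarrow> 'b::real_normed_vector) \<Rightarrow> bool" where
  "smooth_on S f \<longleftrightarrow> (\<forall>k. Ck_on k f S)"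

text \<open>Functions on \<open>\<Omega>\<close> with compact support in \<open>\<Omega>\<close> are identified with their extensions by
  zero to the whole space.\<close>

definition test_functions :: "'a::euclidean_space set \<Rightarrow> ('a \<Rightarrow> complex) set" where
  "test_functions \<Omega> =
     {f. smooth_on UNIV f \<and> compact (closure {x. f x \<noteq> 0}) \<and> closure {x. f x \<noteq> 0} \<subseteq> \<Omega>}"

text \<open>The norm is \<open>\<infinity>\<close> for a function that is not \<open>p\<close>-integrable.\<close>

definition Lp_norm :: "real \<Rightarrow> ('a::euclidean_space \<Rightarrow> complex) \<Rightarrow> ennreal" where
  "Lp_norm p g =
     (let I = (\<integral>\<^sup>+ x. ennreal (cmod (g x) powr p) \<partial>lborel)
      in if I = \<infinity> then \<infinity> else ennreal (enn2real I powr (1 / p)))"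

section \<open>Vector fields\<close>

text \<open>A vector field on \<open>\<real>\<^sup>n\<close> is given by its coefficient function.\<close>

definition vf_apply ::
    "('a::euclidean_space \<Rightarrow> 'a) \<Rightarrow> ('a \<Rightarrow> 'b::real_normed_vector) \<Rightarrow> 'a \<Rightarrow> 'b" where
  "vf_apply X f x = frechet_derivative f (at x) (X x)"

text \<open>The coefficients of the commutator \<open>[X, Y] = XY - YX\<close>.\<close>

definition lie_bracket ::
    "('a::euclidean_space \<Rightarrow> 'a) \<Rightarrow> ('a \<Rightarrow> 'a) \<Rightarrow> 'a \<Rightarrow> 'a" where
  "lie_bracket X Y x = vf_apply X Y x - vf_apply Y X x"

inductive_set lie_generated :: "('a::euclidean_space \<Rightarrow> 'a) set \<Rightarrow> ('a \<Rightarrow> 'a) set"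
  for S where
  gen: "X \<in> S \<Longrightarrow> X \<in> lie_generated S"
| zero: "(\<lambda>_. 0) \<in> lie_generated S"
| add: "X \<in> lie_generated S \<Longrightarrow> Y \<in> lie_generated S \<Longrightarrow> (\<lambda>x. X x + Y x) \<in> lie_generated S"
| scale: "X \<in> lie_generated S \<Longrightarrow> (\<lambda>x. c *\<^sub>R X x) \<in> lie_generated S"
| bracket: "X \<in> lie_generated S \<Longrightarrow> Y \<in> lie_generated S \<Longrightarrow> lie_bracket X Y \<in> lie_generated S"

section \<open>Stratified groups\<close>

locale lie_group_on_euclidean_space = group G for G :: "'a::euclidean_space monoid" (structure) +
  assumes carrier_UNIV: "carrier G = UNIV"
    and smooth_mult: "smooth_on UNIV (\<lambda>(x, y). x \<otimes>\<^bsub>G\<^esub> y)"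
    and smooth_inv: "smooth_on UNIV (m_inv G)"

definition left_invariant :: "'a::euclidean_space monoid \<Rightarrow> ('a \<Rightarrow> 'a) \<Rightarrow> bool" where
  "left_invariant G X \<longleftrightarrow> smooth_on UNIV X \<and>
     (\<forall>a x. frechet_derivative (\<lambda>y. a \<otimes>\<^bsub>G\<^esub> y) (at x) (X x) = X (a \<otimes>\<^bsub>G\<^esub> x))"

text \<open>The decomposition \<open>\<real>\<^sup>n = \<real>\<^bsup>N\<^esup> \<times> \<real>\<^bsup>N\<^sub>2\<^esup> \<times> \<dots> \<times> \<real>\<^bsup>N\<^sub>r\<^esup>\<close> is encoded by the function \<open>\<sigma>\<close> sending a
  coordinate index to the number of the block that contains it, so that \<open>N\<^sub>k = card {i. \<sigma> i = k}\<close>.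
  The index type is not ordered, so the blocks need not be consecutive.\<close>

definition first_stratum :: "('n::finite \<Rightarrow> nat) \<Rightarrow> 'n set" where
  "first_stratum \<sigma> = {i. \<sigma> i = 1}"

definition dilation :: "('n::finite \<Rightarrow> nat) \<Rightarrow> real \<Rightarrow> real^'n \<Rightarrow> real^'n" where
  "dilation \<sigma> t x = (\<chi> i. t ^ \<sigma> i * x $ i)"

text \<open>The fields \<open>X k\<close> with \<open>k\<close> in the first stratum are determined by \<open>G\<close>, because a left invariant
  field is determined by its value at \<open>0\<close>, which is the neutral element (it is fixed by all
  dilations); the values of \<open>X\<close> outside the first stratum are irrelevant.\<close>

locale stratified_group = lie_group_on_euclidean_space G
  for G :: "(real^'n) monoid" (structure) +
  fixes \<sigma> :: "'n \<Rightarrow> nat" and X :: "'n \<Rightarrow> real^'n \<Rightarrow> real^'n"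
  assumes stratum_pos: "\<sigma> i \<ge> 1"
    and dilation_iso: "t > 0 \<Longrightarrow> dilation \<sigma> t \<in> iso G G"
    and X_left_invariant: "k \<in> first_stratum \<sigma> \<Longrightarrow> left_invariant G (X k)"
    and X_at_0: "k \<in> first_stratum \<sigma> \<Longrightarrow> X k 0 = axis k 1"
    and hoermander_rank:
      "dim ((\<lambda>Y. Y x) ` lie_generated (X ` first_stratum \<sigma>)) = CARD('n)"

definition horizontal_norm :: "('n::finite \<Rightarrow> nat) \<Rightarrow> real^'n \<Rightarrow> real" where
  "horizontal_norm \<sigma> x = sqrt (\<Sum>k\<in>first_stratum \<sigma>. (x $ k)\<^sup>2)"

definition horizontal_nonzero :: "('n::finite \<Rightarrow> nat) \<Rightarrow> (real^'n) set" where
  "horizontal_nonzero \<sigma> = UNIV - {x. \<forall>k\<in>first_stratum \<sigma>. x $ k = 0}"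

text \<open>\<open>x' \<cdot> \<nabla>\<^sub>H f\<close>\<close>

definition horizontal_radial ::
    "('n::finite \<Rightarrow> nat) \<Rightarrow> ('n \<Rightarrow> real^'n \<Rightarrow> real^'n) \<Rightarrow> (real^'n \<Rightarrow> complex) \<Rightarrow> real^'n \<Rightarrow> complex" where
  "horizontal_radial \<sigma> X f x = (\<Sum>k\<in>first_stratum \<sigma>. of_real (x $ k) * vf_apply (X k) f x)"

end

theory Submission
  imports Defs
begin

text \<open>Let \<open>Z = x' \<cdot> \<nabla>\<^sub>H\<close>, a vector field on \<open>\<real>\<^sup>n\<close>. Left invariance makes the coefficients of
  \<open>X\<^sub>k\<close> homogeneous under the dilations, and smoothness at \<open>0\<close> then forces the first-stratum
  coefficients of \<open>X\<^sub>k\<close> to be constant and its divergence to vanish. Hence \<open>div Z = N\<close> and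
  \<open>Z \<bar>x'\<bar> = \<bar>x'\<bar>\<close>; integrating the divergence of \<open>\<bar>f\<bar>\<^sup>p \<bar>x'\<bar> powr (- \<alpha> p) Z\<close> and applying Young's
  inequality gives the bound.

  For sharpness take \<open>f = \<bar>x'\<bar> powr (- l)\<close> with \<open>l = (N - \<alpha> p) / p\<close>, cut off at
  \<open>0 \<le> ln \<bar>x'\<bar> \<le> m\<close> and at distance \<open>R\<close> (in the sense of the dilations) in the other variables.
  Then \<open>Z f = - l f\<close> up to errors. Those of the first cut-off live on two shells whose mass does not
  depend on \<open>m\<close>, those of the second are \<open>O(1 / R)\<close> because \<open>Z\<close> commutes with dilations and
  \<open>x'\<close> stays bounded, whereas the norm of \<open>f\<close> grows with \<open>m\<close>.\<close>

section \<open>Calculus of \<open>C\<^sup>k\<close> functions\<close>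

text \<open>The exponent of the profile is chosen so that its weighted p-th power is |x'| powr (-N).
  This density times Lebesgue measure is invariant under scaling x' alone, so every unit interval of
  ln |x'| carries the same mass and the main term grows linearly in m.

  The obstacle is the second cut-off. The coefficients of X_k in the higher strata need not be
  constant, so Z moves the other variables too, with a speed proportional to |x'|, which may be as
  large as exp (m + 1). Hence R has to be chosen after m, while the mass of a shell depends on R.
  What saves the argument is that the errors live in boxes of size 2R, whose mass is 2 ^ Q times
  that of the boxes of size R, where Q is the sum of \<sigma> j outside the first stratum. The mass
  of one unit shell then cancels from the final estimate.

  In the inequality itself, 1 < p makes |f| powr p differentiable even at the zeros of f, so the
  modulus is never regularised; the factor |f| powr (p - 2) in its derivative is tamed by
  Cauchy-Schwarz, which supplies one more |f|.\<close>

lemma Ck_on_cong: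
  assumes "open S" "\<And>x. x \<in> S \<Longrightarrow> f x = g x"
  shows "Ck_on k f S \<longleftrightarrow> Ck_on k g S"
  using assms(2)
proof (induction k arbitrary: f g)
  case 0
  then show ?case by (simp cong: continuous_on_cong)
next
  case (Suc k)
  have d: "(f has_derivative D) (at x) \<longleftrightarrow> (g has_derivative D) (at x)" if "x \<in> S" for x D
    using has_derivative_transform_within_open[OF _ \<open>open S\<close> that] Suc.prems by metis
  then have "f differentiable at x \<longleftrightarrow> g differentiable at x" if "x \<in> S" for x
    using that by (auto simp: differentiable_def)
  moreover have "frechet_derivative f (at x) = frechet_derivative g (at x)" if "x \<in> S" for x
    using d[OF that] by (simp add: frechet_derivative_def)
  then have "Ck_on k (\<lambda>x. frechet_derivative f (at x) v) S \<longleftrightarrow> Ck_on k (\<lambda>x. frechet_derivative g (at x) v) S" for v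
    by (intro Suc.IH) auto
  ultimately show ?case by simp
qed

lemma Ck_on_Un:
  "open S \<Longrightarrow> open T \<Longrightarrow> Ck_on k f S \<Longrightarrow> Ck_on k f T \<Longrightarrow> Ck_on k f (S \<union> T)"
  by (induction k arbitrary: f) (auto intro: continuous_on_open_Un)

lemma Ck_on_const: "Ck_on k (\<lambda>x. c) S"
  by (induction k arbitrary: c) auto

text \<open>The open sets \<open>S\<close> and \<open>- K\<close> cover the space and
  \<open>f\<close> vanishes on the second. In this way functions with a singularity at u = 0 or on
  x' = 0 become smooth or continuous everywhere once they are cut off.\<close>

lemma Ck_on_extend_zero:
  assumes "open S" "closed K" "K \<subseteq> S" "Ck_on k f S" "\<And>x. x \<notin> K \<Longrightarrow> f x = 0"
  shows "Ck_on k f UNIV"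
proof -
  have "Ck_on k f (- K)"
    using Ck_on_cong[of "- K" f "\<lambda>_. 0" k] Ck_on_const[of k 0 "- K"] assms by auto
  then have "Ck_on k f (S \<union> - K)"
    using assms by (intro Ck_on_Un) auto
  moreover have "S \<union> - K = UNIV" using assms by auto
  ultimately show ?thesis by simp
qed

lemma Ck_on_SucI:
  assumes "open S" "\<And>x. x \<in> S \<Longrightarrow> (f has_derivative f' x) (at x)"
    and "\<And>v. Ck_on k (\<lambda>x. f' x v) S"
  shows "Ck_on (Suc k) f S"
proof -
  have *: "frechet_derivative f (at x) = f' x" if "x \<in> S" for x
    using assms(2)[OF that] frechet_derivative_at by fastforce
  have "Ck_on k (\<lambda>x. frechet_derivative f (at x) v) S" for v
    using Ck_on_cong[OF \<open>open S\<close>, of "\<lambda>x. frechet_derivative f (at x) v" "\<lambda>x. f' x v" k] * assms(3) by simp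
  then show ?thesis using assms(2) by (auto simp: differentiable_def)
qed

lemma Ck_on_SucD:
  assumes "Ck_on (Suc k) f S"
  shows "x \<in> S \<Longrightarrow> (f has_derivative frechet_derivative f (at x)) (at x)"
    and "Ck_on k (\<lambda>x. frechet_derivative f (at x) v) S"
  using assms by (auto simp flip: frechet_derivative_works)

lemma Ck_on_Suc_imp: "Ck_on (Suc k) f S \<Longrightarrow> Ck_on k f S"
proof (induction k arbitrary: f)
  case 0
  then show ?case
    by (auto intro!: continuous_at_imp_continuous_on differentiable_imp_continuous_within)
next
  case (Suc k)
  show ?case
    unfolding Ck_on.simps(2)[of k]
    using Suc.prems Suc.IH Ck_on.simps(2) by blast
qed

lemma Ck_on_add:
  assumes "open S"
  shows "Ck_on k f S \<Longrightarrow> Ck_on k g S \<Longrightarrow> Ck_on k (\<lambda>x. f x + g x) S"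
proof (induction k arbitrary: f g)
  case 0
  then show ?case by (simp add: continuous_on_add)
next
  case (Suc k)
  show ?case
    by (rule Ck_on_SucI[OF \<open>open S\<close> has_derivative_add[OF Ck_on_SucD(1)[OF Suc.prems(1)] Ck_on_SucD(1)[OF Suc.prems(2)]]])
       (use Suc in auto)
qed

lemma Ck_on_bounded_linear:
  assumes "open S" "bounded_linear L"
  shows "Ck_on k f S \<Longrightarrow> Ck_on k (\<lambda>x. L (f x)) S"
proof (induction k arbitrary: f)
  case 0
  then show ?case using assms(2) by (simp add: linear_continuous_on_compose bounded_linear.continuous_on)
next
  case (Suc k)
  show ?case
    by (rule Ck_on_SucI[OF \<open>open S\<close> bounded_linear.has_derivative[OF assms(2) Ck_on_SucD(1)[OF Suc.prems]]])
       (use Suc in auto)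
qed

lemma Ck_on_linear:
  assumes "open S" "bounded_linear L"
  shows "Ck_on k L S"
proof (cases k)
  case 0
  then show ?thesis using assms(2) by (simp add: linear_continuous_on)
next
  case (Suc m)
  show ?thesis unfolding Suc
    by (rule Ck_on_SucI[OF \<open>open S\<close> bounded_linear_imp_has_derivative[OF assms(2)]]) (rule Ck_on_const)
qed

lemma Ck_on_mult:
  fixes f g :: "'a::euclidean_space \<Rightarrow> 'b::real_normed_algebra"
  assumes "open S"
  shows "Ck_on k f S \<Longrightarrow> Ck_on k g S \<Longrightarrow> Ck_on k (\<lambda>x. f x * g x) S"
proof (induction k arbitrary: f g)
  case 0
  then show ?case by (simp add: continuous_on_mult)
next
  case (Suc k)
  have fg: "Ck_on k f S" "Ck_on k g S" "Ck_on k (\<lambda>x. frechet_derivative f (at x) v) S"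
    "Ck_on k (\<lambda>x. frechet_derivative g (at x) w) S" for v w
    using Suc.prems Ck_on_Suc_imp Ck_on_SucD(2) by blast+
  show ?case
    by (rule Ck_on_SucI[OF \<open>open S\<close> has_derivative_mult[OF Ck_on_SucD(1)[OF Suc.prems(1)] Ck_on_SucD(1)[OF Suc.prems(2)]]])
       (assumption | rule Ck_on_add Suc.IH assms fg)+
qed

lemma Ck_on_sum:
  assumes "open S" "\<And>i. i \<in> I \<Longrightarrow> Ck_on k (f i) S"
  shows "Ck_on k (\<lambda>x. \<Sum>i\<in>I. f i x) S"
  using assms(2)
  by (induction I rule: infinite_finite_induct) (auto intro: Ck_on_const Ck_on_add[OF assms(1)])

lemma Ck_on_prod:
  fixes f :: "'i \<Rightarrow> 'a::euclidean_space \<Rightarrow> 'b::{real_normed_algebra,comm_ring_1}"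
  assumes "open S" "\<And>i. i \<in> I \<Longrightarrow> Ck_on k (f i) S"
  shows "Ck_on k (\<lambda>x. \<Prod>i\<in>I. f i x) S"
  using assms(2)
  by (induction I rule: infinite_finite_induct) (auto intro: Ck_on_const Ck_on_mult[OF assms(1)])

text \<open>For a real outer function the derivative is the product
  \<open>?f' x v * ?g' (f x) 1\<close>, so the induction closes with \<open>Ck_on_mult\<close>. With
  an outer function of several variables the direction of its derivative would vary with
  \<open>x\<close>.\<close>

lemma Ck_on_compose:
  fixes g :: "real \<Rightarrow> real" and f :: "'a::euclidean_space \<Rightarrow> real"
  assumes "open S" "f ` S \<subseteq> T"
  shows "Ck_on k f S \<Longrightarrow> Ck_on k g T \<Longrightarrow> Ck_on k (\<lambda>x. g (f x)) S"
proof (induction k arbitrary: g)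
  case 0
  then show ?case using assms by (auto intro: continuous_on_compose2)
next
  case (Suc k)
  let ?f' = "\<lambda>x. frechet_derivative f (at x)" and ?g' = "\<lambda>y. frechet_derivative g (at y)"
  have d: "((\<lambda>x. g (f x)) has_derivative (\<lambda>v. ?f' x v * ?g' (f x) 1)) (at x)" if "x \<in> S" for x
  proof -
    have g: "(g has_derivative ?g' (f x)) (at (f x))"
      using Ck_on_SucD(1)[OF Suc.prems(2)] assms(2) that by auto
    have "?g' (f x) r = r * ?g' (f x) 1" for r
      using linear_cmul[OF has_derivative_linear[OF g], of r 1] by simp
    then have "(\<lambda>v. ?g' (f x) (?f' x v)) = (\<lambda>v. ?f' x v * ?g' (f x) 1)"
      by blast
    with has_derivative_compose[OF Ck_on_SucD(1)[OF Suc.prems(1) that] g] show ?thesis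
      by simp
  qed
  have fg: "Ck_on k f S" "Ck_on k (\<lambda>x. frechet_derivative f (at x) v) S"
    "Ck_on k (\<lambda>y. frechet_derivative g (at y) w) T" for v w
    using Suc.prems Ck_on_Suc_imp Ck_on_SucD(2) by blast+
  show ?case
    by (rule Ck_on_SucI[OF \<open>open S\<close> d])
       (assumption | rule fg Ck_on_mult assms Suc.IH)+
qed

lemma Ck_on_DERIV:
  fixes g g' :: "real \<Rightarrow> real"
  assumes "open S" "\<And>x. x \<in> S \<Longrightarrow> (g has_real_derivative g' x) (at x)" "Ck_on k g' S"
  shows "Ck_on (Suc k) g S"
  by (rule Ck_on_SucI[OF assms(1) assms(2)[unfolded has_field_derivative_def]])
     (assumption | rule assms Ck_on_mult Ck_on_const)+

lemma Ck_on_inverse: "Ck_on k (inverse :: real \<Rightarrow> real) {0<..}"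
proof (induction k)
  case (Suc k)
  have "((inverse :: real \<Rightarrow> real) has_real_derivative (-1) * (inverse x * inverse x)) (at x)" if "x \<in> {0<..}" for x
    using that by (auto intro!: derivative_eq_intros simp: power2_eq_square)
  then show ?case
    by (rule Ck_on_DERIV[rotated]) (assumption | rule Suc Ck_on_mult Ck_on_const open_greaterThan)+
qed (auto intro!: continuous_intros)

lemma Ck_on_exp: "Ck_on k (exp :: real \<Rightarrow> real) UNIV"
proof (induction k)
  case (Suc k)
  show ?case
    by (rule Ck_on_DERIV[OF _ _ Suc]) (auto intro!: DERIV_exp)
qed (auto intro!: continuous_intros)

lemma Ck_on_ln: "Ck_on k (ln :: real \<Rightarrow> real) {0<..}"
proof (cases k)
  case (Suc m)
  show ?thesis unfolding Suc
    by (rule Ck_on_DERIV[OF _ _ Ck_on_inverse]) (auto intro!: derivative_eq_intros simp: field_simps)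
qed (auto intro!: continuous_intros)

lemma Ck_on_powr: "Ck_on k (\<lambda>x::real. x powr a) {0<..}"
proof -
  have "Ck_on k (\<lambda>x::real. exp (a * ln x)) {0<..}"
    by (rule Ck_on_compose[where f = "\<lambda>x. a * ln x" and g = exp and T = UNIV])
       (auto intro!: Ck_on_mult Ck_on_const Ck_on_ln Ck_on_exp)
  then show ?thesis
    by (subst (asm) Ck_on_cong[where g = "\<lambda>x. x powr a"]) (auto simp: powr_def)
qed

section \<open>A smooth step between 0 and 1\<close>

definition flat_exp :: "nat \<Rightarrow> real \<Rightarrow> real" where
  "flat_exp n t = (if t \<le> 0 then 0 else inverse t ^ n * exp (- inverse t))"

lemma flat_exp_at_0: "((\<lambda>t. flat_exp n t) \<longlongrightarrow> 0) (at 0)"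
proof -
  have "((\<lambda>t. inverse t ^ n / exp (inverse t)) \<longlongrightarrow> (0::real)) (at_right 0)"
    by (rule filterlim_compose[OF tendsto_power_div_exp_0 filterlim_inverse_at_top_right])
  then have r: "((\<lambda>t. flat_exp n t) \<longlongrightarrow> 0) (at_right 0)"
    by (rule Lim_transform_eventually)
       (auto simp: flat_exp_def exp_minus field_simps eventually_at_filter)
  have l: "((\<lambda>t. flat_exp n t) \<longlongrightarrow> 0) (at_left 0)"
    by (rule Lim_transform_eventually[OF tendsto_const])
       (auto simp: flat_exp_def eventually_at_filter)
  show ?thesis using l r by (simp add: filterlim_at_split)
qed

text \<open>The factor \<open>inverse t ^ n\<close> in \<open>flat_exp\<close> makes the family
  closed under differentiation, which is what the induction for \<open>Ck_on\<close> needs. At 0 the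
  difference quotient of \<open>flat_exp n\<close> is \<open>flat_exp (n + 1)\<close>, which tends
  to 0.\<close>

lemma flat_exp_DERIV:
  "(flat_exp n has_real_derivative flat_exp (n + 2) t - real n * flat_exp (n + 1) t) (at t)"
proof -
  consider "t < 0" | "t = 0" | "t > 0" by linarith
  then show ?thesis
  proof cases
    case 1
    have "(flat_exp n has_real_derivative 0) (at t)"
      by (rule has_field_derivative_transform_within_open[of "\<lambda>_. 0" _ _ "{..<0}"])
         (use 1 in \<open>auto simp: flat_exp_def\<close>)
    then show ?thesis using 1 by (simp add: flat_exp_def)
  next
    case 2
    have "((\<lambda>h. (flat_exp n h - flat_exp n 0) / h) \<longlongrightarrow> 0) (at 0)"
      by (rule Lim_transform_eventually[OF flat_exp_at_0[of "n + 1"]])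
         (auto simp: flat_exp_def eventually_at_filter field_simps)
    then show ?thesis using 2 by (simp add: DERIV_def flat_exp_def)
  next
    case 3
    have i: "((\<lambda>t. inverse t) has_real_derivative - (inverse t * inverse t)) (at t)"
      using 3 by (auto intro!: derivative_eq_intros simp: power2_eq_square)
    have "((\<lambda>t. inverse t ^ n * exp (- inverse t)) has_real_derivative
        real n * (- (inverse t * inverse t)) * inverse t ^ (n - Suc 0) * exp (- inverse t)
          + exp (- inverse t) * (inverse t * inverse t) * inverse t ^ n) (at t)"
      by (rule derivative_eq_intros i refl)+ simp
    also have "real n * (- (inverse t * inverse t)) * inverse t ^ (n - Suc 0) * exp (- inverse t)
          + exp (- inverse t) * (inverse t * inverse t) * inverse t ^ n
        = flat_exp (n + 2) t - real n * flat_exp (n + 1) t"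
      using 3 by (cases n) (auto simp: flat_exp_def algebra_simps)
    finally have "((\<lambda>t. inverse t ^ n * exp (- inverse t)) has_real_derivative
        flat_exp (n + 2) t - real n * flat_exp (n + 1) t) (at t)" .
    then show ?thesis
      by (rule has_field_derivative_transform_within_open[of _ _ _ "{0<..}"])
         (use 3 in \<open>auto simp: flat_exp_def\<close>)
  qed
qed

lemma Ck_on_flat_exp: "Ck_on k (flat_exp n) UNIV"
proof (induction k arbitrary: n)
  case 0
  show ?case using flat_exp_DERIV
    by (auto intro!: continuous_at_imp_continuous_on DERIV_isCont)
next
  case (Suc k)
  have "Ck_on k (\<lambda>t. flat_exp (n + 2) t + (- real n) * flat_exp (n + 1) t) UNIV"
    by (intro Ck_on_add Ck_on_mult Suc Ck_on_const open_UNIV)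
  then show ?case
    by (intro Ck_on_DERIV[OF open_UNIV flat_exp_DERIV]) simp
qed

text \<open>The quotient e(t) / (e(t) + e(1 - t)) with e = \<open>flat_exp 0\<close> has a positive
  denominator because t and 1 - t are never both nonpositive. Its derivative is continuous on [0, 1]
  and the step is locally constant outside, which gives the bound \<open>K\<close>. That bound is
  kept in the statement because the errors of the cut-off in ln |x'| must be controlled uniformly in
  their position.\<close>

lemma smooth_step_exists:
  obtains s :: "real \<Rightarrow> real" and K :: real
  where "\<And>k. Ck_on k s UNIV" "\<And>t. 0 \<le> s t" "\<And>t. s t \<le> 1" "\<And>t. t \<le> 0 \<Longrightarrow> s t = 0"
    "\<And>t. t \<ge> 1 \<Longrightarrow> s t = 1" "\<And>t. (s has_real_derivative deriv s t) (at t)" "\<And>t. \<bar>deriv s t\<bar> \<le> K"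
    "\<And>t. t < 0 \<or> 1 < t \<Longrightarrow> deriv s t = 0"
proof -
  let ?e = "flat_exp 0"
  define s where "s t = ?e t * inverse (?e t + ?e (1 - t))" for t
  have pos: "?e t + ?e (1 - t) > 0" for t by (auto simp: flat_exp_def intro: add_pos_pos)
  have e1: "Ck_on k (\<lambda>t. ?e (1 - t)) UNIV" for k
  proof -
    have "Ck_on k (\<lambda>t::real. 1 + (-1) * t) UNIV"
      by (intro Ck_on_add Ck_on_mult Ck_on_const open_UNIV Ck_on_linear bounded_linear_ident)
    then show ?thesis
      using Ck_on_compose[where T = UNIV and f = "\<lambda>t. 1 - t", OF _ _ _ Ck_on_flat_exp] by simp
  qed
  have "Ck_on k (\<lambda>t. inverse (?e t + ?e (1 - t))) UNIV" for k
    by (rule Ck_on_compose[where T = "{0<..}" and g = inverse])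
       (use pos in \<open>auto intro!: Ck_on_inverse Ck_on_add e1 Ck_on_flat_exp\<close>)
  then have sm: "Ck_on k s UNIV" for k
    unfolding s_def by (intro Ck_on_mult Ck_on_flat_exp open_UNIV)
  have nn: "?e t \<ge> 0" for t by (auto simp: flat_exp_def)
  have s0: "s t = 0" if "t \<le> 0" for t using that by (simp add: s_def flat_exp_def)
  have s1: "s t = 1" if "t \<ge> 1" for t using that by (simp add: s_def flat_exp_def)
  have s01: "0 \<le> s t" "s t \<le> 1" for t
    using nn[of t] nn[of "1 - t"] pos[of t] by (auto simp: s_def field_simps)
  have diff: "s differentiable at t" for t using sm[of "Suc 0"] by auto
  then have DER: "(s has_real_derivative deriv s t) (at t)" for t
    using DERIV_deriv_iff_real_differentiable by blast
  have D: "deriv s t = frechet_derivative s (at t) 1" for t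
    using frechet_derivative_at[OF DER[unfolded has_field_derivative_def]] by (metis mult.right_neutral)
  have "continuous_on {0..1} (deriv s)"
    unfolding D[abs_def] using sm[of "Suc 0"] by (auto intro: continuous_on_subset)
  then have "bounded (deriv s ` {0..1})"
    using compact_continuous_image compact_imp_bounded by blast
  then obtain K where "\<forall>t\<in>{0..1}. \<bar>deriv s t\<bar> \<le> K"
    by (auto simp: bounded_iff)
  then have K: "\<bar>deriv s t\<bar> \<le> K" if "t \<in> {0..1}" for t using that by blast
  have out: "deriv s t = 0" if "t < 0 \<or> 1 < t" for t
    using that
  proof
    assume "t < 0"
    have "(s has_real_derivative 0) (at t)"
      by (rule has_field_derivative_transform_within_open[of "\<lambda>_. 0" _ _ "{..<0}"])
         (use \<open>t < 0\<close> s0 in auto)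
    then show ?thesis by (rule DERIV_imp_deriv)
  next
    assume "1 < t"
    have "(s has_real_derivative 0) (at t)"
      by (rule has_field_derivative_transform_within_open[of "\<lambda>_. 1" _ _ "{1<..}"])
         (use \<open>1 < t\<close> s1 in auto)
    then show ?thesis by (rule DERIV_imp_deriv)
  qed
  have "0 \<le> K" using K[of 0] by simp
  then have "\<bar>deriv s t\<bar> \<le> K" for t using K[of t] out[of t] by (cases "t \<in> {0..1}") auto
  then show thesis using that[of s K] sm s0 s1 s01 DER out by blast
qed

section \<open>Integration on Euclidean space\<close>

text \<open>At z = 0 the difference quotient of |z| powr p has norm |z| powr (p - 1), which tends to
  0 because 1 < p. The formula remains correct there, since the inner product contains the factor z
  = 0.\<close>

lemma has_derivative_norm_powr:
  fixes f :: "'a::real_normed_vector \<Rightarrow> 'b::real_inner"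
  assumes "1 < p" "(f has_derivative f') (at x)"
  shows "((\<lambda>x. norm (f x) powr p) has_derivative (\<lambda>w. p * norm (f x) powr (p - 2) * (f x \<bullet> f' w))) (at x)"
proof -
  have "((\<lambda>z. norm z powr p) has_derivative (\<lambda>w. p * norm z powr (p - 2) * (z \<bullet> w))) (at z)" for z :: 'b
  proof (cases "z = 0")
    case True
    have "((\<lambda>w::'b. norm w powr (p - 1)) \<longlongrightarrow> 0 powr (p - 1)) (at 0)"
      using assms(1) by (intro tendsto_powr2 tendsto_const tendsto_norm_zero tendsto_ident_at always_eventually) auto
    moreover have "\<forall>\<^sub>F w in at (0::'b). norm w powr (p - 1) = norm (norm w powr p) / norm w"
      by (auto simp: eventually_at_filter powr_diff)
    ultimately have "((\<lambda>w::'b. norm (norm w powr p) / norm w) \<longlongrightarrow> 0) (at 0)"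
      using Lim_transform_eventually by fastforce
    then show ?thesis using True by (simp add: has_derivative_at)
  next
    case False
    have "((\<lambda>z. norm z powr p) has_derivative
        (\<lambda>w. norm z powr p * (0 * ln (norm z) + (w \<bullet> sgn z) * p / norm z))) (at z)"
      by (rule has_derivative_powr[OF has_derivative_norm has_derivative_const]) (use False in auto)
    moreover have "norm z powr p * (0 * ln (norm z) + (w \<bullet> sgn z) * p / norm z)
        = p * norm z powr (p - 2) * (z \<bullet> w)" for w
      using False by (simp add: sgn_div_norm powr_diff inner_commute power2_eq_square divide_simps)
    ultimately show ?thesis by simp
  qed
  from has_derivative_compose[OF assms(2) this] show ?thesis .
qed

lemma integrable_continuous_compact_support:
  fixes h :: "'a::euclidean_space \<Rightarrow> 'b::{banach, second_countable_topology}"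
  assumes "compact K" "continuous_on UNIV h" "\<And>x. x \<notin> K \<Longrightarrow> h x = 0"
  shows "integrable lborel h"
proof -
  have "(\<lambda>x. indicator K x *\<^sub>R h x) = h" using assms(3) by (auto simp: indicator_def)
  with borel_integrable_compact[OF assms(1) continuous_on_subset[OF assms(2)]] show ?thesis by simp
qed

lemma lborel_integral_translate:
  fixes h :: "'a::euclidean_space \<Rightarrow> real"
  assumes "integrable lborel h"
  shows "integrable lborel (\<lambda>x. h (x + c))" "(\<integral>x. h (x + c) \<partial>lborel) = (\<integral>x. h x \<partial>lborel)"
proof -
  have d: "distr lborel borel (\<lambda>x. x + c) = lborel"
    using lborel_distr_plus[of c] by (simp add: add.commute[of c] cong: distr_cong)
  have [measurable]: "h \<in> borel_measurable borel" using assms by simp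
  have m: "(\<lambda>x. x + c) \<in> measurable lborel borel" by simp
  show "integrable lborel (\<lambda>x. h (x + c))"
    using integrable_distr_eq[OF m, of h] assms d by simp
  show "(\<integral>x. h (x + c) \<partial>lborel) = (\<integral>x. h x \<partial>lborel)"
    using integral_distr[OF m, of h] d by simp
qed

text \<open>Translation invariance makes the integrals of the difference quotients vanish.\<close>

lemma integral_directional_derivative_eq_0:
  fixes h :: "'a::euclidean_space \<Rightarrow> real"
  assumes K: "compact K" "\<And>x. x \<notin> K \<Longrightarrow> h x = 0"
    and h': "\<And>x. (h has_derivative h' x) (at x)"
    and M: "\<And>x. \<bar>h' x v\<bar> \<le> M"
  shows "integrable lborel (\<lambda>x. h' x v)" "(\<integral>x. h' x v \<partial>lborel) = 0"
proof -
  have cont: "continuous_on UNIV h"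
    using h' has_derivative_continuous continuous_at_imp_continuous_on by blast
  have hint: "integrable lborel h"
    by (rule integrable_continuous_compact_support[OF K(1) cont K(2)])
  have "0 \<le> M" using M[of undefined] by linarith
  \<comment> \<open>All points whose segment x + t v with t in [0, 1] meets \<open>K\<close>. The
    steps 1 / (n + 1) do not exceed 1, so every difference quotient vanishes off this one compact
    set and a multiple of its indicator dominates them all.\<close>
  define K' where "K' = (\<lambda>(x, t). x - t *\<^sub>R v) ` (K \<times> {0..1::real})"
  have K': "compact K'"
    unfolding K'_def
    by (intro compact_continuous_image compact_Times K compact_Icc)
       (simp add: case_prod_beta, intro continuous_intros)
  define s where "s n x = (h (x + (1 / real (Suc n)) *\<^sub>R v) - h x) * real (Suc n)" for n x
  have der: "((\<lambda>t. h (x + t *\<^sub>R v)) has_real_derivative h' (x + t *\<^sub>R v) v) (at t)" for x t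
  proof -
    have "((\<lambda>t. h (x + t *\<^sub>R v)) has_derivative (\<lambda>r. h' (x + t *\<^sub>R v) (r *\<^sub>R v))) (at t)"
      by (rule has_derivative_compose[OF _ h', of "\<lambda>t. x + t *\<^sub>R v"]) (auto intro!: derivative_eq_intros)
    then show ?thesis
      by (simp add: has_field_derivative_def linear_cmul[OF has_derivative_linear[OF h']] mult_commute_abs)
  qed
  have bound: "norm (s n x) \<le> M * indicator K' x" for n x
  proof (cases "x \<in> K'")
    case True
    have "0 < 1 / real (Suc n)" by simp
    then obtain z where "h (x + (1 / real (Suc n)) *\<^sub>R v) - h (x + 0 *\<^sub>R v)
        = (1 / real (Suc n) - 0) * h' (x + z *\<^sub>R v) v"
      using MVT2[of 0 "1 / real (Suc n)" "\<lambda>t. h (x + t *\<^sub>R v)" "\<lambda>t. h' (x + t *\<^sub>R v) v"] der by blast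
    then have "s n x = h' (x + z *\<^sub>R v) v" by (simp add: s_def)
    then show ?thesis using M True by simp
  next
    case False
    have "x + t *\<^sub>R v \<notin> K" if "t \<in> {0..1}" for t
    proof
      assume "x + t *\<^sub>R v \<in> K"
      then have "(\<lambda>(x, t). x - t *\<^sub>R v) (x + t *\<^sub>R v, t) \<in> K'"
        unfolding K'_def using that by blast
      with False show False by simp
    qed
    from this[of 0] this[of "1 / real (Suc n)"] show ?thesis
      using K(2) \<open>0 \<le> M\<close> by (simp add: s_def)
  qed
  have lim: "(\<lambda>n. s n x) \<longlonglongrightarrow> h' x v" for x
  proof -
    have "(\<lambda>t. (h (x + t *\<^sub>R v) - h x) / t) \<midarrow>0\<rightarrow> h' x v"
      using der[of x 0] by (simp add: DERIV_def)
    moreover have "filterlim (\<lambda>n. 1 / real (Suc n)) (at 0) sequentially"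
      using LIMSEQ_inverse_real_of_nat by (simp add: filterlim_at inverse_eq_divide)
    ultimately show ?thesis
      using filterlim_compose by (fastforce simp: s_def)
  qed
  have m[measurable]: "h \<in> borel_measurable borel" using hint by simp
  have sm: "s n \<in> borel_measurable lborel" for n unfolding s_def by measurable
  \<comment> \<open>Of the derivative only a bound is given, so its measurability comes from the
    limit of the quotients.\<close>
  have h'm: "(\<lambda>x. h' x v) \<in> borel_measurable lborel"
    by (rule borel_measurable_LIMSEQ_metric[OF sm lim])
  have w: "integrable lborel (\<lambda>x. M * indicator K' x)"
    using borel_integrable_compact[OF K', of "\<lambda>_. M"] by (simp add: mult.commute)
  show "integrable lborel (\<lambda>x. h' x v)"
    by (rule integrable_dominated_convergence[where s = s, OF h'm sm w]) (use lim bound in auto)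
  have "(\<lambda>n. \<integral>x. s n x \<partial>lborel) \<longlonglongrightarrow> (\<integral>x. h' x v \<partial>lborel)"
    by (rule integral_dominated_convergence[where s = s, OF h'm sm w]) (use lim bound in auto)
  moreover have "(\<integral>x. s n x \<partial>lborel) = 0" for n
    unfolding s_def using lborel_integral_translate[OF hint] hint by simp
  ultimately show "(\<integral>x. h' x v \<partial>lborel) = 0"
    by (simp add: LIMSEQ_const_iff)
qed

section \<open>Norms, inequalities for powers and diagonal substitutions\<close>

lemma Lp_norm_cmult_le_iff:
  assumes "0 < p" "0 \<le> C" "0 \<le> I" "0 \<le> J"
    and "(\<integral>\<^sup>+ x. ennreal (cmod (g x) powr p) \<partial>lborel) = ennreal I"
    and "(\<integral>\<^sup>+ x. ennreal (cmod (h x) powr p) \<partial>lborel) = ennreal J"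
  shows "ennreal C * Lp_norm p g \<le> Lp_norm p h \<longleftrightarrow> C powr p * I \<le> J"
proof -
  have "ennreal C * Lp_norm p g \<le> Lp_norm p h \<longleftrightarrow> C * I powr (1 / p) \<le> J powr (1 / p)"
    using assms by (simp add: Lp_norm_def flip: ennreal_mult)
  also have "\<dots> \<longleftrightarrow> (C * I powr (1 / p)) powr p \<le> (J powr (1 / p)) powr p"
    using assms by (smt (verit) mult_nonneg_nonneg powr_ge_zero powr_less_mono2 powr_mono2)
  also have "\<dots> \<longleftrightarrow> C powr p * I \<le> J"
    using assms by (simp add: powr_mult powr_powr)
  finally show ?thesis .
qed

lemma Young_powr:
  fixes u w p :: real
  assumes "1 < p" "0 \<le> u" "0 \<le> w"
  shows "u powr (p - 1) * w \<le> (1 - 1 / p) * u powr p + w powr p / p"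
proof -
  have "w * u powr (p - 1) \<le> w powr p / p + (u powr (p - 1)) powr (p / (p - 1)) / (p / (p - 1))"
    using assms by (intro Youngs_inequality) (auto simp: field_simps)
  moreover have "(p - 1) * (p / (p - 1)) = p" using assms by simp
  ultimately show ?thesis using assms by (simp add: powr_powr) (simp add: field_simps)
qed

text \<open>Convexity of the power, applied to a + b as the combination of a / (1 - \<tau>) and b /
  \<tau> with weights 1 - \<tau> and \<tau>. As \<tau> tends to 0 the factor of the first term tends
  to 1; the price is a large factor on the second, which is harmless for an error term.\<close>

lemma add_powr_le_split:
  fixes a b p \<tau> :: real
  assumes "1 \<le> p" "0 \<le> a" "0 \<le> b" "0 < \<tau>" "\<tau> < 1"
  shows "(a + b) powr p \<le> (1 - \<tau>) powr (1 - p) * a powr p + \<tau> powr (1 - p) * b powr p"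
proof (cases "a = 0 \<or> b = 0")
  case True
  have "1 \<le> \<tau> powr (1 - p)" "1 \<le> (1 - \<tau>) powr (1 - p)"
    using assms powr_mono'[of "1 - p" 0 \<tau>] powr_mono'[of "1 - p" 0 "1 - \<tau>"] by auto
  then show ?thesis
    using True assms mult_right_mono[of 1 "\<tau> powr (1 - p)" "b powr p"]
      mult_right_mono[of 1 "(1 - \<tau>) powr (1 - p)" "a powr p"] by auto
next
  case False
  have "((1 - \<tau>) *\<^sub>R (a / (1 - \<tau>)) + \<tau> *\<^sub>R (b / \<tau>)) powr p
      \<le> (1 - \<tau>) * (a / (1 - \<tau>)) powr p + \<tau> * (b / \<tau>) powr p"
    using assms False by (intro convex_onD[OF powr_convex]) auto
  then show ?thesis
    using assms by (simp add: powr_divide powr_diff)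
qed

text \<open>\<open>lborel_affine_euclidean\<close> takes its factors indexed by basis vectors, and
  \<open>c'\<close> carries the factors over from the indices. Each coordinate has its own factor
  because \<open>shell_mass_scale\<close> scales x' independently of the other variables.\<close>

lemma nn_integral_lborel_diagonal:
  fixes c :: "'n::finite \<Rightarrow> real" and h :: "real^'n \<Rightarrow> ennreal"
  assumes "\<And>i. 0 < c i" and [measurable]: "h \<in> borel_measurable borel"
  shows "(\<integral>\<^sup>+x. h x \<partial>lborel) = ennreal (\<Prod>i\<in>UNIV. c i) * (\<integral>\<^sup>+x. h (\<chi> i. c i * x $ i) \<partial>lborel)"
proof -
  define c' :: "real^'n \<Rightarrow> real" where "c' b = (\<Sum>i\<in>UNIV. c i * b $ i)" for b
  have c': "c' (axis i 1) = c i" for i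
    by (simp add: c'_def axis_def if_distrib cong: if_cong)
  have B: "(Basis :: (real^'n) set) = range (\<lambda>i. axis i 1)"
    by (auto simp: Basis_vec_def)
  have inj: "inj (\<lambda>i::'n. axis i (1::real))"
    by (auto simp: inj_on_def axis_eq_axis)
  have T: "(\<Sum>j\<in>Basis. (c' j * (x \<bullet> j)) *\<^sub>R j) = (\<chi> i. c i * x $ i)" for x :: "real^'n"
    unfolding B using inj
    by (simp add: sum.reindex c' inner_axis) (simp add: vec_eq_iff axis_def if_distrib cong: if_cong)
  have P: "(\<Prod>j\<in>Basis. \<bar>c' j\<bar>) = (\<Prod>i\<in>UNIV. c i)"
    unfolding B using inj assms(1) by (simp add: prod.reindex c' less_imp_le)
  let ?T = "\<lambda>x::real^'n. \<chi> i. c i * x $ i"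
  have L: "lborel = density (distr lborel borel ?T) (\<lambda>_. ennreal (\<Prod>i\<in>UNIV. c i))"
  proof -
    have "c' j \<noteq> 0" if "j \<in> Basis" for j
      using that assms(1) unfolding B by (auto simp: c' less_imp_neq[THEN not_sym])
    from lborel_affine_euclidean[of c' 0, OF this] show ?thesis unfolding T P by simp
  qed
  have "?T \<in> borel_measurable borel"
    by (intro borel_measurable_continuous_onI continuous_intros)
  then have [measurable]: "?T \<in> borel_measurable lborel" by simp
  have "(\<integral>\<^sup>+x. h x \<partial>lborel) = (\<integral>\<^sup>+x. h x \<partial>density (distr lborel borel ?T) (\<lambda>_. ennreal (\<Prod>i\<in>UNIV. c i)))"
    using L by (rule arg_cong)
  also have "\<dots> = ennreal (\<Prod>i\<in>UNIV. c i) * (\<integral>\<^sup>+x. h (?T x) \<partial>lborel)"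
    by (simp add: nn_integral_density nn_integral_cmult nn_integral_distr)
  finally show ?thesis .
qed

section \<open>Left invariant horizontal fields\<close>

lemma bounded_linear_dilation: "bounded_linear (dilation \<sigma> t)"
  by (intro linear_conv_bounded_linear[THEN iffD1] linearI) (auto simp: dilation_def vec_eq_iff algebra_simps)

lemma dilation_axis: "dilation \<sigma> t (axis k c) = t ^ \<sigma> k *\<^sub>R axis k c"
  by (simp add: dilation_def vec_eq_iff axis_def)

definition radial_field :: "('n::finite \<Rightarrow> nat) \<Rightarrow> ('n \<Rightarrow> real^'n \<Rightarrow> real^'n) \<Rightarrow> real^'n \<Rightarrow> real^'n" where
  "radial_field \<sigma> X x = (\<Sum>k\<in>first_stratum \<sigma>. (x $ k) *\<^sub>R X k x)"

lemma horizontal_radial_eq: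
  assumes "f differentiable (at x)"
  shows "horizontal_radial \<sigma> X f x = frechet_derivative f (at x) (radial_field \<sigma> X x)"
proof -
  have l: "linear (frechet_derivative f (at x))" by (rule linear_frechet_derivative[OF assms])
  show ?thesis
    by (simp add: horizontal_radial_def radial_field_def vf_apply_def linear_sum[OF l] linear_cmul[OF l])
       (simp add: scaleR_conv_of_real)
qed

context stratified_group
begin

lemma one_eq_0: "\<one> = 0"
proof -
  have "dilation \<sigma> 2 \<in> hom G G" using dilation_iso[of 2] by (simp add: iso_def)
  then have "dilation \<sigma> 2 \<one> = \<one>" using hom_one is_group by blast
  then have "2 ^ \<sigma> i * \<one> $ i = \<one> $ i" for i by (simp add: dilation_def vec_eq_iff)
  moreover have "1 < (2::real) ^ \<sigma> i" for i
    by (rule one_less_power) (use stratum_pos[of i] in auto)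
  then have "(2::real) ^ \<sigma> i \<noteq> 1" for i by (metis less_irrefl)
  ultimately show ?thesis by (simp add: vec_eq_iff)
qed

lemma left_translation_has_derivative:
  "((\<lambda>y. a \<otimes> y) has_derivative frechet_derivative (\<lambda>y. a \<otimes> y) (at x)) (at x)"
proof -
  have "Ck_on (Suc 0) (\<lambda>(x, y). x \<otimes> y) UNIV" using smooth_mult by (simp add: smooth_on_def)
  then obtain D where "((\<lambda>(x, y). x \<otimes> y) has_derivative D) (at (a, x))"
    by (auto simp: differentiable_def) blast
  from has_derivative_compose[OF has_derivative_Pair[OF has_derivative_const has_derivative_ident] this]
  have "(\<lambda>y. a \<otimes> y) differentiable (at x)" by (auto simp: differentiable_def)
  then show ?thesis by (simp add: frechet_derivative_works)
qed

text \<open>Left invariance at the neutral element. It expresses the field through the group law,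
  the only object about which the dilations give information.\<close>

lemma horizontal_field_eq:
  assumes "k \<in> first_stratum \<sigma>"
  shows "X k a = frechet_derivative (\<lambda>y. a \<otimes> y) (at 0) (axis k 1)"
proof -
  have "frechet_derivative (\<lambda>y. a \<otimes> y) (at 0) (X k 0) = X k (a \<otimes> 0)"
    using X_left_invariant[OF assms] unfolding left_invariant_def by blast
  moreover have "a \<otimes> 0 = a" using one_eq_0 r_one[of a] carrier_UNIV by simp
  ultimately show ?thesis using X_at_0[OF assms] by simp
qed

text \<open>Differentiate \<open>?d (a \<otimes> y) = ?d a \<otimes> ?d y\<close> at y = 0 in the
  direction \<open>axis k 1\<close>, which the dilation multiplies by \<open>t\<close> because
  \<open>k\<close> lies in the first stratum.\<close>

lemma horizontal_field_dilation:
  assumes "k \<in> first_stratum \<sigma>" "0 < t"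
  shows "dilation \<sigma> t (X k a) = t *\<^sub>R X k (dilation \<sigma> t a)"
proof -
  let ?d = "dilation \<sigma> t"
  let ?L = "\<lambda>a. frechet_derivative (\<lambda>y. a \<otimes> y) (at 0)"
  have "?d \<in> hom G G" using dilation_iso[OF assms(2)] by (simp add: iso_def)
  then have eq: "?d (a \<otimes> y) = ?d a \<otimes> ?d y" for y using carrier_UNIV by (simp add: hom_def)
  have "((\<lambda>y. ?d (a \<otimes> y)) has_derivative (\<lambda>v. ?d (?L a v))) (at 0)"
    by (rule bounded_linear.has_derivative[OF bounded_linear_dilation left_translation_has_derivative])
  moreover have "((\<lambda>y. ?d a \<otimes> ?d y) has_derivative (\<lambda>v. ?L (?d a) (?d v))) (at 0)"
  proof (rule has_derivative_compose[where f = ?d and f' = ?d and g' = "?L (?d a)"])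
    show "(?d has_derivative ?d) (at 0)"
      by (rule bounded_linear_imp_has_derivative[OF bounded_linear_dilation])
    show "((\<lambda>y. ?d a \<otimes> y) has_derivative ?L (?d a)) (at (?d 0))"
      using left_translation_has_derivative[of "?d a" 0]
      by (simp add: linear_0[OF bounded_linear.linear[OF bounded_linear_dilation]])
  qed
  ultimately have "?d (?L a v) = ?L (?d a) (?d v)" for v
    unfolding eq using has_derivative_unique by metis
  moreover have "?d (axis k 1) = t *\<^sub>R axis k 1"
    using assms(1) by (simp add: dilation_axis first_stratum_def)
  moreover have "linear (?L (?d a))"
    using left_translation_has_derivative has_derivative_linear by blast
  ultimately show ?thesis
    using horizontal_field_eq[OF assms(1)] by (simp add: linear_cmul)
qed

lemma dilation_tendsto_0: "((\<lambda>t. dilation \<sigma> t x) \<longlongrightarrow> 0) (at_right 0)"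
proof (rule vec_tendstoI)
  fix i
  have "((\<lambda>t. t ^ \<sigma> i * x $ i) \<longlongrightarrow> 0 ^ \<sigma> i * x $ i) (at_right 0)"
    by (intro tendsto_intros)
  then show "((\<lambda>t. dilation \<sigma> t x $ i) \<longlongrightarrow> 0 $ i) (at_right 0)"
    using stratum_pos[of i] by (simp add: dilation_def zero_power)
qed

lemma horizontal_field_Ck: "k \<in> first_stratum \<sigma> \<Longrightarrow> Ck_on m (X k) UNIV"
  using X_left_invariant by (simp add: left_invariant_def smooth_on_def)

lemma horizontal_field_has_derivative:
  "k \<in> first_stratum \<sigma> \<Longrightarrow> (X k has_derivative frechet_derivative (X k) (at x)) (at x)"
  using horizontal_field_Ck[of k "Suc 0"] by (simp flip: frechet_derivative_works)

lemma continuous_horizontal_field_derivative: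
  "k \<in> first_stratum \<sigma> \<Longrightarrow> continuous_on UNIV (\<lambda>x. frechet_derivative (X k) (at x) v)"
  using horizontal_field_Ck[of k "Suc 0"] by simp

text \<open>A continuous function that is homogeneous of degree \<open>0\<close> is constant.\<close>

lemma horizontal_field_first_stratum:
  assumes k: "k \<in> first_stratum \<sigma>" and j: "j \<in> first_stratum \<sigma>"
  shows "X k x $ j = (if j = k then 1 else 0)"
proof -
  have eq: "X k (dilation \<sigma> t x) $ j = X k x $ j" if "0 < t" for t
    using arg_cong[OF horizontal_field_dilation[OF k that, of x], of "\<lambda>v. v $ j"] that j
    by (simp add: dilation_def first_stratum_def)
  have "isCont (X k) 0"
    using horizontal_field_has_derivative[OF k] has_derivative_continuous by blast
  then have "((\<lambda>t. X k (dilation \<sigma> t x) $ j) \<longlongrightarrow> X k 0 $ j) (at_right 0)"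
    by (intro tendsto_vec_nth isCont_tendsto_compose[OF _ dilation_tendsto_0])
  moreover have "((\<lambda>t. X k (dilation \<sigma> t x) $ j) \<longlongrightarrow> X k x $ j) (at_right 0)"
    by (rule Lim_transform_eventually[OF tendsto_const]) (auto simp: eq eventually_at_filter)
  ultimately have "X k x $ j = X k 0 $ j"
    using tendsto_unique trivial_limit_at_right_real by blast
  then show ?thesis using X_at_0[OF k] by (simp add: axis_def)
qed

text \<open>The derivative in question is homogeneous of degree \<open>-1\<close> and continuous at \<open>0\<close>.\<close>

lemma horizontal_field_diagonal_derivative:
  assumes k: "k \<in> first_stratum \<sigma>"
  shows "frechet_derivative (X k) (at x) (axis j 1) $ j = 0"
proof -
  let ?D = "\<lambda>x. frechet_derivative (X k) (at x)"
  \<comment> \<open>Differentiating \<open>horizontal_field_dilation\<close> in the direction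
    \<open>axis j 1\<close> and taking the component \<open>j\<close> produces t ^ \<sigma> j on the
    left and t * t ^ \<sigma> j on the right. For a diagonal entry these powers of the same block
    cancel, leaving a single factor \<open>t\<close>.\<close>
  have eq: "t * (?D (dilation \<sigma> t x) (axis j 1) $ j) = ?D x (axis j 1) $ j" if "0 < t" for t
  proof -
    let ?d = "dilation \<sigma> t"
    have "((\<lambda>y. ?d (X k y)) has_derivative (\<lambda>v. ?d (?D x v))) (at x)"
      by (rule bounded_linear.has_derivative[OF bounded_linear_dilation horizontal_field_has_derivative[OF k]])
    moreover have "((\<lambda>y. t *\<^sub>R X k (?d y)) has_derivative (\<lambda>v. t *\<^sub>R ?D (?d x) (?d v))) (at x)"
      by (rule has_derivative_scaleR_right, rule has_derivative_compose[where f = ?d and f' = ?d])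
         (rule bounded_linear_imp_has_derivative[OF bounded_linear_dilation] horizontal_field_has_derivative[OF k])+
    ultimately have "?d (?D x v) = t *\<^sub>R ?D (?d x) (?d v)" for v
      unfolding horizontal_field_dilation[OF k that] using has_derivative_unique by metis
    from arg_cong[OF this[of "axis j 1"], of "\<lambda>v. v $ j"] show ?thesis
      using that linear_cmul[OF has_derivative_linear[OF horizontal_field_has_derivative[OF k]]]
      by (simp add: dilation_axis) (simp add: dilation_def)
  qed
  have "isCont (\<lambda>x. ?D x (axis j 1)) 0"
    using continuous_horizontal_field_derivative[OF k] continuous_on_eq_continuous_at by blast
  then have "((\<lambda>t. t * (?D (dilation \<sigma> t x) (axis j 1) $ j)) \<longlongrightarrow> 0 * (?D 0 (axis j 1) $ j)) (at_right 0)"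
    by (intro tendsto_mult tendsto_ident_at tendsto_vec_nth isCont_tendsto_compose[OF _ dilation_tendsto_0])
  moreover have "((\<lambda>t. t * (?D (dilation \<sigma> t x) (axis j 1) $ j)) \<longlongrightarrow> ?D x (axis j 1) $ j) (at_right 0)"
    by (rule Lim_transform_eventually[OF tendsto_const]) (auto simp: eq eventually_at_filter)
  ultimately show ?thesis
    using tendsto_unique trivial_limit_at_right_real by fastforce
qed

text \<open>Without generators the generated Lie algebra is {0}, whose rank is less than the
  dimension of the space. A nonempty first stratum is what gives the shells below positive
  mass.\<close>

lemma first_stratum_nonempty: "first_stratum \<sigma> \<noteq> {}"
proof
  assume empty: "first_stratum \<sigma> = {}"
  have "Y = (\<lambda>_. 0)" if "Y \<in> lie_generated (X ` first_stratum \<sigma>)" for Y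
    using that by induction (auto simp: empty lie_bracket_def vf_apply_def)
  then have "(\<lambda>Y. Y 0) ` lie_generated (X ` first_stratum \<sigma>) \<subseteq> {0}" by auto
  then have "dim ((\<lambda>Y. Y 0) ` lie_generated (X ` first_stratum \<sigma>)) \<le> dim {0 :: real^'n}"
    by (rule dim_subset)
  then show False using hoermander_rank[of 0] by simp
qed

definition radial_derivative :: "real^'n \<Rightarrow> real^'n \<Rightarrow> real^'n" where
  "radial_derivative x v =
    (\<Sum>k\<in>first_stratum \<sigma>. (x $ k) *\<^sub>R frechet_derivative (X k) (at x) v + (v $ k) *\<^sub>R X k x)"

lemma radial_field_has_derivative:
  "(radial_field \<sigma> X has_derivative radial_derivative x) (at x)"
  unfolding radial_field_def[abs_def] radial_derivative_def[abs_def]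
  by (rule has_derivative_sum, rule has_derivative_scaleR)
     (rule bounded_linear_imp_has_derivative[OF bounded_linear_vec_nth], rule horizontal_field_has_derivative)

lemma continuous_radial_derivative: "continuous_on UNIV (\<lambda>x. radial_derivative x v)"
  unfolding radial_derivative_def
  by (intro continuous_intros continuous_horizontal_field_derivative horizontal_field_Ck[of _ 0, simplified])

lemma continuous_radial_field: "continuous_on UNIV (radial_field \<sigma> X)"
  by (intro continuous_at_imp_continuous_on ballI has_derivative_continuous[OF radial_field_has_derivative])

lemma radial_field_first_stratum: "j \<in> first_stratum \<sigma> \<Longrightarrow> radial_field \<sigma> X x $ j = x $ j"
  by (simp add: radial_field_def horizontal_field_first_stratum if_distrib cong: if_cong sum.cong)

lemma radial_field_divergence:
  "(\<Sum>j\<in>UNIV. radial_derivative x (axis j 1) $ j) = card (first_stratum \<sigma>)"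
proof -
  have "(\<Sum>j\<in>UNIV. radial_derivative x (axis j 1) $ j)
      = (\<Sum>k\<in>first_stratum \<sigma>. \<Sum>j\<in>UNIV. axis j 1 $ k * X k x $ j)"
    by (subst sum.swap) (simp add: radial_derivative_def horizontal_field_diagonal_derivative)
  also have "\<dots> = (\<Sum>k\<in>first_stratum \<sigma>. X k x $ k)"
    by (simp add: axis_def if_distrib[of "\<lambda>c. c * _"] cong: if_cong)
  also have "\<dots> = card (first_stratum \<sigma>)"
    by (simp add: horizontal_field_first_stratum)
  finally show ?thesis .
qed

text \<open>The factor \<open>t\<close> that X_k releases under the dilation is exactly the one that
  the coordinate x_k of the first stratum acquires. Hence Z applied to a dilated cut-off is the
  dilate of Z applied to the cut-off.\<close>

lemma radial_field_dilation:
  assumes "0 < t"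
  shows "dilation \<sigma> t (radial_field \<sigma> X x) = radial_field \<sigma> X (dilation \<sigma> t x)"
proof -
  have l: "linear (dilation \<sigma> t)" using bounded_linear_dilation bounded_linear.linear by blast
  have "dilation \<sigma> t x $ k = t * x $ k" if "k \<in> first_stratum \<sigma>" for k
    using that by (simp add: dilation_def first_stratum_def)
  then show ?thesis
    using assms by (simp add: radial_field_def linear_sum[OF l] linear_cmul[OF l] horizontal_field_dilation mult.commute)
qed

end

section \<open>The Hardy inequality\<close>

text \<open>The square is used in place of |x'| because it is a polynomial, smooth also where x' =
  0; powers of |x'| become powers with half the exponent.\<close>

definition horizontal_sq :: "('n::finite \<Rightarrow> nat) \<Rightarrow> real^'n \<Rightarrow> real" where
  "horizontal_sq \<sigma> x = (\<Sum>k\<in>first_stratum \<sigma>. (x $ k)\<^sup>2)"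

lemma horizontal_sq_nonneg: "0 \<le> horizontal_sq \<sigma> x"
  by (simp add: horizontal_sq_def sum_nonneg)

lemma horizontal_sq_eq_0_iff: "horizontal_sq \<sigma> x = 0 \<longleftrightarrow> (\<forall>k\<in>first_stratum \<sigma>. x $ k = 0)"
  by (simp add: horizontal_sq_def sum_nonneg_eq_0_iff)

lemma horizontal_nonzero_iff: "x \<in> horizontal_nonzero \<sigma> \<longleftrightarrow> 0 < horizontal_sq \<sigma> x"
  using horizontal_sq_nonneg[of \<sigma> x] horizontal_sq_eq_0_iff[of \<sigma> x]
  by (auto simp: horizontal_nonzero_def)

lemma continuous_horizontal_sq: "continuous_on S (horizontal_sq \<sigma>)"
  unfolding horizontal_sq_def by (intro continuous_intros)

lemma open_horizontal_nonzero: "open (horizontal_nonzero \<sigma>)"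
proof -
  have "horizontal_nonzero \<sigma> = {x. 0 < horizontal_sq \<sigma> x}"
    by (auto simp: horizontal_nonzero_iff)
  then show ?thesis
    by (simp add: open_Collect_less continuous_horizontal_sq)
qed

lemma horizontal_norm_powr: "horizontal_norm \<sigma> x powr a = horizontal_sq \<sigma> x powr (a / 2)"
  using horizontal_sq_nonneg[of \<sigma> x]
  by (simp add: horizontal_norm_def horizontal_sq_def[symmetric] powr_half_sqrt[symmetric] powr_powr)

lemma horizontal_sq_has_derivative:
  "(horizontal_sq \<sigma> has_derivative (\<lambda>w. 2 * (\<Sum>k\<in>first_stratum \<sigma>. x $ k * w $ k))) (at x)"
proof -
  have "((\<lambda>x. x $ k) has_derivative (\<lambda>w. w $ k)) (at x)" for x :: "real^'n" and k
    by (rule bounded_linear_imp_has_derivative[OF bounded_linear_vec_nth])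
  then show ?thesis
    unfolding horizontal_sq_def[abs_def] sum_distrib_left
    by (auto intro!: derivative_eq_intros simp: mult_ac)
qed

lemma horizontal_sq_powr_has_derivative:
  assumes "x \<in> horizontal_nonzero \<sigma>"
  shows "((\<lambda>x. horizontal_sq \<sigma> x powr b) has_derivative
    (\<lambda>w. 2 * b * horizontal_sq \<sigma> x powr (b - 1) * (\<Sum>k\<in>first_stratum \<sigma>. x $ k * w $ k))) (at x)"
proof -
  have "0 < horizontal_sq \<sigma> x" using assms horizontal_nonzero_iff by blast
  then have "((\<lambda>x. horizontal_sq \<sigma> x powr b) has_derivative
    (\<lambda>w. horizontal_sq \<sigma> x powr b * (0 * ln (horizontal_sq \<sigma> x)
       + (2 * (\<Sum>k\<in>first_stratum \<sigma>. x $ k * w $ k)) * b / horizontal_sq \<sigma> x))) (at x)"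
    by (intro has_derivative_powr horizontal_sq_has_derivative has_derivative_const) auto
  then show ?thesis
    using \<open>0 < horizontal_sq \<sigma> x\<close> by (simp add: powr_diff mult_ac)
qed

lemma continuous_on_UNIV_extend_zero:
  fixes f :: "'a::euclidean_space \<Rightarrow> 'b::real_normed_vector"
  assumes "open S" "compact K" "K \<subseteq> S" "continuous_on S f" "\<And>x. x \<notin> K \<Longrightarrow> f x = 0"
  shows "continuous_on UNIV f"
  using Ck_on_extend_zero[of S K 0 f] assms by (simp add: compact_imp_closed)

lemma bounded_continuous_compact_support:
  fixes f :: "'a::euclidean_space \<Rightarrow> real"
  assumes "compact K" "continuous_on UNIV f" "\<And>x. x \<notin> K \<Longrightarrow> f x = 0"
  obtains M where "\<And>x. \<bar>f x\<bar> \<le> M"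
proof -
  have "bounded (f ` K)"
    using assms(1) continuous_on_subset[OF assms(2)]
    by (intro compact_imp_bounded compact_continuous_image) auto
  then obtain M where "\<forall>x\<in>K. \<bar>f x\<bar> \<le> M" by (auto simp: bounded_iff)
  then have "\<bar>f x\<bar> \<le> max M 0" for x using assms(3)[of x] by (cases "x \<in> K") auto
  then show thesis by (rule that)
qed

text \<open>Only continuity and the support of \<open>\<phi>\<close> enter, so that both sides of
  the inequality are covered: \<open>\<phi>\<close> is \<open>f\<close> in one case and
  \<open>horizontal_radial \<sigma> X f\<close> in the other. The weight is continuous on the
  compact support, hence both norms are finite.\<close>

lemma weighted_nn_integral:
  fixes \<phi> :: "real^'n \<Rightarrow> complex" and \<sigma> :: "'n \<Rightarrow> nat"
  assumes K: "compact K" "K \<subseteq> horizontal_nonzero \<sigma>" and "continuous_on UNIV \<phi>"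
    and 0: "\<And>x. x \<notin> K \<Longrightarrow> \<phi> x = 0" and "0 < p"
  shows "integrable lborel (\<lambda>x. cmod (\<phi> x) powr p * horizontal_sq \<sigma> x powr (- \<alpha> * p / 2))"
    and "(\<integral>\<^sup>+x. ennreal (cmod (\<phi> x / of_real (horizontal_norm \<sigma> x powr \<alpha>)) powr p) \<partial>lborel)
      = ennreal (\<integral>x. cmod (\<phi> x) powr p * horizontal_sq \<sigma> x powr (- \<alpha> * p / 2) \<partial>lborel)"
proof -
  let ?g = "\<lambda>x. cmod (\<phi> x) powr p * horizontal_sq \<sigma> x powr (- \<alpha> * p / 2)"
  have "continuous_on UNIV ?g"
  proof (rule continuous_on_UNIV_extend_zero[OF open_horizontal_nonzero K])
    show "continuous_on (horizontal_nonzero \<sigma>) ?g"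
      using assms(3,5) continuous_on_subset
      by (intro continuous_intros continuous_on_powr' continuous_horizontal_sq)
         (auto simp: horizontal_nonzero_iff horizontal_sq_nonneg)
  qed (simp add: 0)
  then show int: "integrable lborel ?g"
    by (rule integrable_continuous_compact_support[OF K(1)]) (simp add: 0)
  have eq: "cmod (\<phi> x / of_real (horizontal_norm \<sigma> x powr \<alpha>)) powr p = ?g x" for x
  proof (cases "x \<in> K")
    case True
    then have "0 < horizontal_sq \<sigma> x" using K(2) horizontal_nonzero_iff by blast
    then show ?thesis
      by (simp add: norm_divide horizontal_norm_powr powr_divide powr_powr powr_minus_divide)
  qed (simp add: 0)
  show "(\<integral>\<^sup>+x. ennreal (cmod (\<phi> x / of_real (horizontal_norm \<sigma> x powr \<alpha>)) powr p) \<partial>lborel) = ennreal (\<integral>x. ?g x \<partial>lborel)"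
    unfolding eq by (rule nn_integral_eq_integral[OF int]) auto
qed

context stratified_group
begin

lemma test_function_facts:
  assumes "f \<in> test_functions (horizontal_nonzero \<sigma>)"
  defines "K \<equiv> closure {x. f x \<noteq> 0}"
  shows "compact K" "K \<subseteq> horizontal_nonzero \<sigma>" "\<And>x. x \<notin> K \<Longrightarrow> f x = 0"
    "\<And>x. (f has_derivative frechet_derivative f (at x)) (at x)"
    "\<And>v. continuous_on UNIV (\<lambda>x. frechet_derivative f (at x) v)"
    "continuous_on UNIV f"
    "\<And>x v. x \<notin> K \<Longrightarrow> frechet_derivative f (at x) v = 0"
    "continuous_on UNIV (horizontal_radial \<sigma> X f)"
    "\<And>x. x \<notin> K \<Longrightarrow> horizontal_radial \<sigma> X f x = 0"
    "\<And>x. horizontal_radial \<sigma> X f x = frechet_derivative f (at x) (radial_field \<sigma> X x)"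
proof -
  have sm: "Ck_on k f UNIV" for k using assms by (simp add: test_functions_def smooth_on_def)
  show "compact K" "K \<subseteq> horizontal_nonzero \<sigma>" using assms by (auto simp: test_functions_def)
  show 0: "f x = 0" if "x \<notin> K" for x
    using that closure_subset[of "{x. f x \<noteq> 0}"] by (auto simp: K_def)
  show D: "(f has_derivative frechet_derivative f (at x)) (at x)" for x
    using Ck_on_SucD(1)[OF sm] by blast
  show C: "continuous_on UNIV (\<lambda>x. frechet_derivative f (at x) v)" for v
    using Ck_on_SucD(2)[OF sm[of "Suc 0"]] by simp
  show "continuous_on UNIV f" using sm[of 0] by simp
  show D0: "frechet_derivative f (at x) v = 0" if "x \<notin> K" for x v
  proof -
    have "open (- K)" by (simp add: K_def open_Compl)
    then have "(f has_derivative (\<lambda>_. 0)) (at x)"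
      using has_derivative_transform_within_open[OF has_derivative_const, of "- K" x 0 f] that 0 by simp
    then show ?thesis using frechet_derivative_at by metis
  qed
  have eq: "horizontal_radial \<sigma> X f x = frechet_derivative f (at x) (radial_field \<sigma> X x)" for x
    using D by (intro horizontal_radial_eq) (auto simp: differentiable_def)
  then show "\<And>x. horizontal_radial \<sigma> X f x = frechet_derivative f (at x) (radial_field \<sigma> X x)" .
  show "horizontal_radial \<sigma> X f x = 0" if "x \<notin> K" for x using D0[OF that] eq by simp
  \<comment> \<open>Smoothness gives continuity of the derivative in a fixed direction only. The
    direction here varies with \<open>x\<close>, so it is expanded in the coordinate
    directions.\<close>
  have "frechet_derivative f (at x) (radial_field \<sigma> X x)
      = (\<Sum>j\<in>UNIV. radial_field \<sigma> X x $ j *\<^sub>R frechet_derivative f (at x) (axis j 1))" for x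
  proof -
    have l: "linear (frechet_derivative f (at x))" using D has_derivative_linear by blast
    have "(\<Sum>j\<in>UNIV. radial_field \<sigma> X x $ j *\<^sub>R axis j 1) = radial_field \<sigma> X x"
      by (simp add: vec_eq_iff axis_def if_distrib cong: if_cong)
    from arg_cong[OF this, of "frechet_derivative f (at x)"] show ?thesis
      by (simp add: linear_sum[OF l] linear_cmul[OF l])
  qed
  then show "continuous_on UNIV (horizontal_radial \<sigma> X f)"
    unfolding eq[abs_def]
    by (simp) (intro continuous_intros C continuous_radial_field)
qed

lemma hardy_integral_inequality:
  assumes f: "f \<in> test_functions (horizontal_nonzero \<sigma>)" and p: "1 < p"
  shows "(\<bar>real (card (first_stratum \<sigma>)) - \<alpha> * p\<bar> / p) powr p *
      (\<integral>x. cmod (f x) powr p * horizontal_sq \<sigma> x powr (- \<alpha> * p / 2) \<partial>lborel)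
    \<le> (\<integral>x. cmod (horizontal_radial \<sigma> X f x) powr p * horizontal_sq \<sigma> x powr (- \<alpha> * p / 2) \<partial>lborel)"
proof -
  define K where "K = closure {x. f x \<noteq> 0}"
  note F = test_function_facts[OF f, folded K_def]
  let ?\<Omega> = "horizontal_nonzero \<sigma>"
  let ?D = "\<lambda>x. frechet_derivative f (at x)"
  define N where "N = real (card (first_stratum \<sigma>))"
  define Z where "Z = radial_field \<sigma> X"
  define b where "b = - \<alpha> * p / 2"
  define W where "W x = horizontal_sq \<sigma> x powr b" for x
  define W' where "W' x w = 2 * b * horizontal_sq \<sigma> x powr (b - 1) * (\<Sum>k\<in>first_stratum \<sigma>. x $ k * w $ k)" for x w
  define n where "n x = cmod (f x)" for x
  define g where "g x = n x powr p * W x" for x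
  define g' where "g' x w = n x powr p * W' x w + (p * n x powr (p - 2) * (f x \<bullet> ?D x w)) * W x" for x w
  have g': "(g has_derivative g' x) (at x)" for x
  proof (cases "x \<in> ?\<Omega>")
    case True
    then show ?thesis
      unfolding g_def[abs_def] g'_def[abs_def] n_def W_def W'_def
      by (intro has_derivative_mult has_derivative_norm_powr p F(4) horizontal_sq_powr_has_derivative)
  next
    case False
    then have x: "x \<notin> K" using F(2) by blast
    have "open (- K)" "\<And>y. y \<in> - K \<Longrightarrow> 0 = g y"
      using F(1,3) p by (auto simp: g_def n_def compact_imp_closed open_Compl)
    then have "(g has_derivative (\<lambda>_. 0)) (at x)"
      using has_derivative_transform_within_open[OF has_derivative_const, of "- K" x 0 g] x by simp
    moreover have "g' x = (\<lambda>_. 0)" using F(3)[OF x] by (auto simp: g'_def n_def)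
    ultimately show ?thesis by simp
  qed
  have n_cont: "continuous_on S n" for S
    unfolding n_def by (intro continuous_intros continuous_on_subset[OF F(6)]) auto
  have np_cont: "continuous_on S (\<lambda>x. n x powr a)" if "0 < a" for a S
    using that n_cont by (intro continuous_on_powr' continuous_intros) (auto simp: n_def)
  have W_cont: "continuous_on ?\<Omega> W" "continuous_on ?\<Omega> (\<lambda>x. W' x w)" for w
    unfolding W_def W'_def
    by (auto intro!: continuous_intros continuous_on_powr' continuous_horizontal_sq
        simp: horizontal_nonzero_iff horizontal_sq_nonneg)
  have Z_cont: "continuous_on S Z" for S
    using continuous_radial_field continuous_on_subset unfolding Z_def by blast
  have DZ_cont: "continuous_on S (\<lambda>x. radial_derivative x v)" for S v
    using continuous_radial_derivative continuous_on_subset by blast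
  have D_cont: "continuous_on S (\<lambda>x. ?D x v)" for S v
    using F(5) continuous_on_subset by blast
  have g_int: "integrable lborel g"
    using weighted_nn_integral(1)[OF F(1,2,6,3), of p \<alpha>] p by (simp add: g_def[abs_def] n_def W_def b_def)
  define h' where "h' j x w = g x * radial_derivative x w $ j + g' x w * Z x $ j" for j x w
  have h': "((\<lambda>x. g x * Z x $ j) has_derivative h' j x) (at x)" for j x
    unfolding h'_def[abs_def] Z_def
    by (intro has_derivative_mult g' bounded_linear.has_derivative[OF bounded_linear_vec_nth]
        radial_field_has_derivative)
  have h'_bound: "\<exists>M. \<forall>x. \<bar>h' j x (axis j 1)\<bar> \<le> M" for j
  proof -
    \<comment> \<open>For p < 2 the factor |f| powr (p - 2) in \<open>g'\<close> is singular at the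
      zeros of \<open>f\<close>, which obstructs a direct continuity argument for \<open>h'\<close>.
      Cauchy-Schwarz turns it into |f| powr (p - 1), so \<open>h'\<close> is dominated by the
      continuous, compactly supported \<open>B\<close>.\<close>
    define B where "B x = n x powr p * W x * \<bar>radial_derivative x (axis j 1) $ j\<bar>
      + (n x powr p * \<bar>W' x (axis j 1)\<bar> + p * n x powr (p - 1) * cmod (?D x (axis j 1)) * W x) * \<bar>Z x $ j\<bar>" for x
    have B0: "B x = 0" if "x \<notin> K" for x using F(3)[OF that] by (simp add: B_def n_def)
    have "continuous_on UNIV B"
    proof (rule continuous_on_UNIV_extend_zero[OF open_horizontal_nonzero F(1,2) _ B0])
      show "continuous_on ?\<Omega> B"
        unfolding B_def using p by (intro continuous_intros np_cont W_cont Z_cont DZ_cont D_cont) auto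
    qed
    then obtain M where M: "\<And>x. \<bar>B x\<bar> \<le> M"
      using bounded_continuous_compact_support[of K B, OF F(1) _ B0] by blast
    have W0: "0 \<le> W x" for x by (simp add: W_def)
    have "\<bar>h' j x (axis j 1)\<bar> \<le> B x" for x
    proof -
      have "n x powr (p - 2) * \<bar>f x \<bullet> ?D x (axis j 1)\<bar> \<le> n x powr (p - 2) * (n x * cmod (?D x (axis j 1)))"
        using Cauchy_Schwarz_ineq2[of "f x" "?D x (axis j 1)"] by (intro mult_left_mono) (auto simp: n_def)
      also have "\<dots> = n x powr (p - 1) * cmod (?D x (axis j 1))"
        by (cases "n x = 0") (auto simp: powr_diff n_def power2_eq_square)
      finally have *: "\<bar>p * n x powr (p - 2) * (f x \<bullet> ?D x (axis j 1)) * W x\<bar>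
          \<le> p * n x powr (p - 1) * cmod (?D x (axis j 1)) * W x"
        using p W0[of x] by (simp add: abs_mult mult.assoc mult_left_mono mult_right_mono)
          (simp add: mult.assoc[symmetric] mult_right_mono)
      have "\<bar>g' x (axis j 1)\<bar> \<le> n x powr p * \<bar>W' x (axis j 1)\<bar> + p * n x powr (p - 1) * cmod (?D x (axis j 1)) * W x"
        unfolding g'_def by (rule order_trans[OF abs_triangle_ineq add_mono[OF _ *]]) (simp add: abs_mult)
      then have "\<bar>g' x (axis j 1) * Z x $ j\<bar> \<le> (n x powr p * \<bar>W' x (axis j 1)\<bar> + p * n x powr (p - 1) * cmod (?D x (axis j 1)) * W x) * \<bar>Z x $ j\<bar>"
        by (simp add: abs_mult mult_right_mono)
      moreover have "\<bar>g x * radial_derivative x (axis j 1) $ j\<bar> = n x powr p * W x * \<bar>radial_derivative x (axis j 1) $ j\<bar>"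
        using W0[of x] by (simp add: g_def abs_mult)
      ultimately show ?thesis unfolding h'_def B_def by linarith
    qed
    then show ?thesis using M by (meson abs_le_D1 order_trans)
  qed
  have h'_int: "integrable lborel (\<lambda>x. h' j x (axis j 1))" "(\<integral>x. h' j x (axis j 1) \<partial>lborel) = 0" for j
  proof -
    obtain M where M: "\<And>x. \<bar>h' j x (axis j 1)\<bar> \<le> M" using h'_bound by blast
    have 0: "g x * Z x $ j = 0" if "x \<notin> K" for x using F(3)[OF that] by (simp add: g_def n_def)
    show "integrable lborel (\<lambda>x. h' j x (axis j 1))" "(\<integral>x. h' j x (axis j 1) \<partial>lborel) = 0"
      using integral_directional_derivative_eq_0[OF F(1) 0 h' M] by blast+
  qed
  define q where "q x = n x powr (p - 2) * (f x \<bullet> ?D x (Z x)) * W x" for x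
  \<comment> \<open>The divergence of g Z. The summand N g is g div Z; the summand - \<alpha> p g
    arises because Z multiplies the weight |x'| powr (- \<alpha> p) by - \<alpha> p; the rest is the
    derivative of |f| powr p along Z, where the real inner product on the complex numbers stands for
    the real part of the product of Zf with the conjugate of f.\<close>
  have sum_h': "(\<Sum>j\<in>UNIV. h' j x (axis j 1)) = (N - \<alpha> * p) * g x + p * q x" for x
  proof -
    have l: "linear (g' x)" using g' has_derivative_linear by blast
    have Zx: "Z x = (\<Sum>j\<in>UNIV. Z x $ j *\<^sub>R axis j 1)"
      by (simp add: vec_eq_iff axis_def if_distrib cong: if_cong)
    have "(\<Sum>j\<in>UNIV. g' x (axis j 1) * Z x $ j) = g' x (\<Sum>j\<in>UNIV. Z x $ j *\<^sub>R axis j 1)"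
      by (simp add: linear_sum[OF l] linear_cmul[OF l] mult.commute)
    then have 1: "(\<Sum>j\<in>UNIV. g' x (axis j 1) * Z x $ j) = g' x (Z x)" using Zx by simp
    have 2: "(\<Sum>j\<in>UNIV. g x * radial_derivative x (axis j 1) $ j) = N * g x"
      by (simp add: sum_distrib_left[symmetric] radial_field_divergence N_def mult.commute)
    have "n x powr p * W' x (Z x) = - \<alpha> * p * g x"
    proof (cases "x \<in> K")
      case True
      then have "0 < horizontal_sq \<sigma> x" using F(2) horizontal_nonzero_iff by blast
      moreover have "(\<Sum>k\<in>first_stratum \<sigma>. x $ k * Z x $ k) = horizontal_sq \<sigma> x"
        by (simp add: Z_def radial_field_first_stratum horizontal_sq_def power2_eq_square)
      ultimately have "W' x (Z x) = 2 * b * W x" by (simp add: W'_def W_def powr_diff)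
      then show ?thesis by (simp add: b_def g_def)
    next
      case False
      then show ?thesis using F(3) by (simp add: g_def n_def)
    qed
    then show ?thesis
      unfolding h'_def sum.distrib 1 2 by (simp add: g'_def q_def algebra_simps)
  qed
  \<comment> \<open>Solved for \<open>q\<close>, the identity yields its integrability from that of
    \<open>h'\<close> and \<open>g\<close>, so the factor |f| powr (p - 2) needs no separate
    treatment.\<close>
  have q_eq: "q x = ((\<Sum>j\<in>UNIV. h' j x (axis j 1)) - (N - \<alpha> * p) * g x) / p" for x
    using sum_h' p by simp
  have q_int: "integrable lborel q"
    unfolding q_eq[abs_def] using h'_int(1) g_int by auto
  have "(\<integral>x. (N - \<alpha> * p) * g x + p * q x \<partial>lborel) = 0"
    unfolding sum_h'[symmetric] using h'_int by simp
  then have "(N - \<alpha> * p) * (\<integral>x. g x \<partial>lborel) + p * (\<integral>x. q x \<partial>lborel) = 0"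
    using g_int q_int by simp
  then have gq: "(N - \<alpha> * p) / p * (\<integral>x. g x \<partial>lborel) = - (\<integral>x. q x \<partial>lborel)"
    using p by (simp add: field_simps)
  define I J where "I = (\<integral>x. g x \<partial>lborel)"
    and "J = (\<integral>x. cmod (horizontal_radial \<sigma> X f x) powr p * W x \<partial>lborel)"
  have J_int: "integrable lborel (\<lambda>x. cmod (horizontal_radial \<sigma> X f x) powr p * W x)"
    using weighted_nn_integral(1)[OF F(1,2,8,9), of p \<alpha>] p by (simp add: W_def b_def)
  define \<kappa> where "\<kappa> = \<bar>N - \<alpha> * p\<bar> / p"
  have I0: "0 \<le> I" unfolding I_def by (simp add: g_def W_def)
  have "\<kappa> powr p * I \<le> J"
  proof (cases "\<kappa> = 0")
    case True
    have "0 \<le> J" unfolding J_def by (simp add: W_def)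
    then show ?thesis using True p by simp
  next
    case False
    then have \<kappa>: "0 < \<kappa>" using p by (simp add: \<kappa>_def)
    \<comment> \<open>Young's inequality is applied to |f| and |Zf| / \<kappa>. The rescaling by
      \<kappa> is what preserves the constant: equality holds when |Zf| = \<kappa> |f|, and after
      integration the part (1 - 1 / p) I is absorbed by I, leaving I / p on the left.\<close>
    have qb: "\<bar>q x\<bar> \<le> \<kappa> * ((1 - 1 / p) * g x + cmod (horizontal_radial \<sigma> X f x) powr p * W x / (\<kappa> powr p * p))" for x
    proof -
      let ?z = "cmod (horizontal_radial \<sigma> X f x)"
      have "n x powr (p - 2) * \<bar>f x \<bullet> ?D x (Z x)\<bar> \<le> n x powr (p - 2) * (n x * ?z)"
        using Cauchy_Schwarz_ineq2[of "f x" "?D x (Z x)"] F(10)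
        by (intro mult_left_mono) (auto simp: n_def Z_def)
      also have "\<dots> = \<kappa> * (n x powr (p - 1) * (?z / \<kappa>))"
        using \<kappa> by (cases "n x = 0") (auto simp: powr_diff n_def power2_eq_square)
      also have "\<dots> \<le> \<kappa> * ((1 - 1 / p) * n x powr p + (?z / \<kappa>) powr p / p)"
        using \<kappa> p by (intro mult_left_mono Young_powr) (auto simp: n_def)
      finally have "n x powr (p - 2) * \<bar>f x \<bullet> ?D x (Z x)\<bar> * W x
          \<le> \<kappa> * ((1 - 1 / p) * n x powr p + (?z / \<kappa>) powr p / p) * W x"
        by (rule mult_right_mono) (simp add: W_def)
      then show ?thesis
        using \<kappa> by (simp add: q_def g_def abs_mult W_def powr_divide algebra_simps)
    qed
    have "\<kappa> * I = \<bar>\<integral>x. q x \<partial>lborel\<bar>"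
      using arg_cong[OF gq, of abs] I0 p by (simp add: \<kappa>_def I_def abs_mult)
    also have "\<dots> \<le> (\<integral>x. \<bar>q x\<bar> \<partial>lborel)" by simp
    also have "\<dots> \<le> (\<integral>x. \<kappa> * ((1 - 1 / p) * g x + cmod (horizontal_radial \<sigma> X f x) powr p * W x / (\<kappa> powr p * p)) \<partial>lborel)"
      using q_int g_int J_int qb by (intro integral_mono) auto
    also have "\<dots> = \<kappa> * ((1 - 1 / p) * I + J / (\<kappa> powr p * p))"
      using g_int J_int by (simp add: I_def J_def)
    finally have "I \<le> (1 - 1 / p) * I + J / (\<kappa> powr p * p)" using \<kappa> by simp
    then have "I / p \<le> J / (\<kappa> powr p * p)" by (simp add: algebra_simps)
    then show ?thesis using \<kappa> p by (simp add: field_simps)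
  qed
  then show ?thesis
    by (simp add: \<kappa>_def N_def I_def J_def g_def[abs_def] n_def W_def b_def)
qed

end

section \<open>Cut-off functions and shells\<close>

text \<open>The counterpart of \<open>Ck_on_compose\<close> for an outer function of several
  variables: the direction \<open>L v\<close> does not depend on \<open>x\<close>, so the induction
  hypothesis applies to the directional derivative itself. It serves the cut-off composed with a
  dilation.\<close>

lemma Ck_on_compose_linear:
  assumes "bounded_linear L"
  shows "Ck_on k f UNIV \<Longrightarrow> Ck_on k (\<lambda>x. f (L x)) UNIV"
proof (induction k arbitrary: f)
  case 0
  then show ?case
    using continuous_on_compose2[OF _ linear_continuous_on[OF assms]] by auto
next
  case (Suc k)
  show ?case
  proof (rule Ck_on_SucI[OF open_UNIV])
    show "((\<lambda>x. f (L x)) has_derivative (\<lambda>v. frechet_derivative f (at (L x)) (L v))) (at x)" for x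
      by (rule has_derivative_compose[OF bounded_linear_imp_has_derivative[OF assms] Ck_on_SucD(1)[OF Suc.prems]]) simp
    show "Ck_on k (\<lambda>x. frechet_derivative f (at (L x)) (L v)) UNIV" for v
      by (rule Suc.IH[OF Ck_on_SucD(2)[OF Suc.prems]])
  qed
qed

text \<open>A product over \<open>B\<close> of one-dimensional cut-offs s(2 - t) s(2 + t): both
  factors are 1 for |t| at most 1, and one of them vanishes as soon as |t| is at least 2.\<close>

lemma smooth_box_cutoff_exists:
  obtains P :: "real^'n \<Rightarrow> real"
  where "\<And>k. Ck_on k P UNIV" "\<And>y. 0 \<le> P y" "\<And>y. P y \<le> 1"
    "\<And>y. (\<And>j. j \<in> B \<Longrightarrow> \<bar>y $ j\<bar> \<le> 1) \<Longrightarrow> P y = 1"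
    "\<And>y j. j \<in> B \<Longrightarrow> 2 \<le> \<bar>y $ j\<bar> \<Longrightarrow> P y = 0"
proof -
  obtain s :: "real \<Rightarrow> real" where sm: "\<And>k. Ck_on k s UNIV"
    and s: "\<And>t. 0 \<le> s t" "\<And>t. s t \<le> 1" "\<And>t. t \<le> 0 \<Longrightarrow> s t = 0" "\<And>t. t \<ge> 1 \<Longrightarrow> s t = 1"
    by (rule smooth_step_exists) blast
  define P where "P y = (\<Prod>j\<in>B. s (2 - y $ j) * s (2 + y $ j))" for y :: "real^'n"
  have c: "Ck_on k (\<lambda>y::real^'n. s (2 + b * y $ j)) UNIV" for k b j
  proof (rule Ck_on_compose[where T = UNIV and g = s])
    show "Ck_on k (\<lambda>y::real^'n. 2 + b * y $ j) UNIV"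
      by (intro Ck_on_add Ck_on_mult Ck_on_const open_UNIV Ck_on_linear[OF open_UNIV bounded_linear_vec_nth])
  qed (auto intro: sm)
  have sm': "Ck_on k P UNIV" for k
    unfolding P_def using c[of k "-1"] c[of k 1] by (intro Ck_on_prod Ck_on_mult open_UNIV) auto
  have one: "P y = 1" if "\<And>j. j \<in> B \<Longrightarrow> \<bar>y $ j\<bar> \<le> 1" for y
    unfolding P_def
  proof (rule prod.neutral, rule ballI)
    fix j assume "j \<in> B"
    then have "\<bar>y $ j\<bar> \<le> 1" by (rule that)
    then show "s (2 - y $ j) * s (2 + y $ j) = 1" using s(4) by (simp add: abs_le_iff)
  qed
  have zero: "P y = 0" if "j \<in> B" "2 \<le> \<bar>y $ j\<bar>" for y j
  proof -
    have "s (2 - y $ j) * s (2 + y $ j) = 0" using that(2) s(3) by (auto simp: abs_if split: if_splits)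
    then show ?thesis unfolding P_def using that(1) by (intro prod_zero) auto
  qed
  show thesis
  proof (rule that[OF sm' _ _ one zero])
    show "0 \<le> P y" for y unfolding P_def by (intro prod_nonneg) (simp add: s)
    show "P y \<le> 1" for y unfolding P_def by (intro prod_le_1) (simp add: s mult_le_one)
  qed auto
qed

text \<open>In the variable \<open>u = \<bar>x'\<bar>\<^sup>2\<close> the extremal profile \<open>\<bar>x'\<bar> powr (- l)\<close> becomes
  \<open>u powr (- l / 2)\<close>; the transition layers have width \<open>1\<close> in \<open>ln \<bar>x'\<bar>\<close>, which is why \<open>K\<close> does not
  depend on \<open>m\<close>.\<close>

lemma truncated_power_exists:
  fixes l :: real
  obtains K where "0 \<le> K"
    "\<And>m. \<exists>g g'. (\<forall>k. Ck_on k g UNIV) \<and> (\<forall>u. (g has_real_derivative g' u) (at u)) \<and>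
      (\<forall>u>0. 0 \<le> g u \<and> g u \<le> u powr (- l / 2)) \<and>
      (\<forall>u. 1 \<le> u \<longrightarrow> u \<le> exp (2 * real m) \<longrightarrow> g u = u powr (- l / 2)) \<and>
      (\<forall>u. u \<le> exp (-2) \<or> exp (2 * (real m + 1)) \<le> u \<longrightarrow> g u = 0) \<and>
      (\<forall>u>0. \<bar>2 * u * g' u + l * g u\<bar> \<le> K * u powr (- l / 2)) \<and>
      (\<forall>u>0. u \<notin> {exp (-4)..<exp 2} \<longrightarrow> u \<notin> {exp (2 * (real m - 1))..<exp (2 * (real m + 2))} \<longrightarrow>
         2 * u * g' u + l * g u = 0)"
proof -
  obtain s K where sm: "\<And>k. Ck_on k s UNIV"
    and s: "\<And>t. 0 \<le> s t" "\<And>t. s t \<le> 1" "\<And>t. t \<le> 0 \<Longrightarrow> s t = 0" "\<And>t. t \<ge> 1 \<Longrightarrow> s t = 1"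
    and s': "\<And>t. (s has_real_derivative deriv s t) (at t)" "\<And>t. \<bar>deriv s t\<bar> \<le> K"
    "\<And>t. t < 0 \<or> 1 < t \<Longrightarrow> deriv s t = 0"
    by (rule smooth_step_exists) blast
  have K: "0 \<le> K" using s'(2)[of 0] by linarith
  show thesis
  proof (rule that[of "2 * K"])
    show "0 \<le> 2 * K" using K by simp
    fix m :: nat
    define L where "L u = ln u / 2" for u :: real
    \<comment> \<open>As \<open>L\<close> is ln |x'|, the first factor rises while L runs from -1 to
      0 and the second falls while L runs from m to m + 1; between 0 and m the power is left
      unchanged.\<close>
    define e where "e u = s (L u + 1) * s (real m + 1 - L u)" for u
    define g where "g u = (if 0 < u then u powr (- l / 2) * e u else 0)" for u
    have L_le: "L u \<le> c \<longleftrightarrow> u \<le> exp (2 * c)" "c \<le> L u \<longleftrightarrow> exp (2 * c) \<le> u" if "0 < u" for u c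
    proof -
      have "ln u \<le> 2 * c \<longleftrightarrow> u \<le> exp (2 * c)" using that by (metis exp_le_cancel_iff exp_ln)
      then show "L u \<le> c \<longleftrightarrow> u \<le> exp (2 * c)" by (simp add: L_def mult.commute)
      show "c \<le> L u \<longleftrightarrow> exp (2 * c) \<le> u"
        using ln_ge_iff[OF that, of "2 * c"] by (simp add: L_def mult.commute)
    qed
    have g0: "g u = 0" if "u \<le> exp (-2) \<or> exp (2 * (real m + 1)) \<le> u" for u
    proof (cases "0 < u")
      case True
      then have "L u \<le> -1 \<or> real m + 1 \<le> L u" using that L_le[OF True] by auto
      then have "e u = 0" using s(3) by (auto simp: e_def)
      then show ?thesis by (simp add: g_def)
    qed (simp add: g_def)
    have "Ck_on k (\<lambda>u. u powr (- l / 2) * e u) {0<..}" for k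
    proof -
      have L: "Ck_on k (\<lambda>u. a + b * ln u) {0<..}" for a b :: real
        by (intro Ck_on_add Ck_on_mult Ck_on_const Ck_on_ln open_greaterThan)
      have "Ck_on k (\<lambda>u. s (a + b * ln u)) {0<..}" for a b
        by (rule Ck_on_compose[OF open_greaterThan _ L sm]) simp
      from this[of 1 "1 / 2"] this[of "real m + 1" "- (1 / 2)"] show ?thesis
        unfolding e_def L_def by (intro Ck_on_mult Ck_on_powr open_greaterThan) (simp_all add: add.commute)
    qed
    then have "Ck_on k g {0<..}" for k
      by (subst Ck_on_cong[where g = "\<lambda>u. u powr (- l / 2) * e u"]) (auto simp: g_def)
    moreover have "{exp (-2)..} \<subseteq> {0::real<..}"
      by (auto intro: less_le_trans[OF exp_gt_zero])
    ultimately have smooth: "Ck_on k g UNIV" for k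
      by (intro Ck_on_extend_zero[of "{0<..}" "{exp (-2)..}" k g]) (auto simp: g0)
    define g' where "g' u = deriv g u" for u
    have g': "(g has_real_derivative g' u) (at u)" for u
      unfolding g'_def using smooth[of "Suc 0"] by (simp add: DERIV_deriv_iff_real_differentiable)
    \<comment> \<open>The operator 2 u d/du is how Z acts on functions of u = |x'| ^ 2. The pure
      power is annihilated by 2 u d/du + l, and 2 u d/du maps L to 1, so only the derivatives of the
      two steps survive, without any factor that depends on u or m.\<close>
    have key: "2 * u * g' u + l * g u =
        u powr (- l / 2) * (deriv s (L u + 1) * s (real m + 1 - L u) - s (L u + 1) * deriv s (real m + 1 - L u))"
      if "0 < u" for u
    proof -
      have DL: "(L has_real_derivative 1 / (2 * u)) (at u)"
        unfolding L_def using that by (auto intro!: derivative_eq_intros)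
      have D1: "((\<lambda>u. s (L u + 1)) has_real_derivative deriv s (L u + 1) * (1 / (2 * u))) (at u)"
        by (rule DERIV_chain2[OF s'(1)]) (auto intro!: derivative_eq_intros DL)
      have D2: "((\<lambda>u. s (real m + 1 - L u)) has_real_derivative deriv s (real m + 1 - L u) * (- (1 / (2 * u)))) (at u)"
        by (rule DERIV_chain2[OF s'(1)]) (auto intro!: derivative_eq_intros DL)
      have D0: "((\<lambda>u. u powr (- l / 2)) has_real_derivative (- l / 2) * u powr (- l / 2 - 1)) (at u)"
        by (rule has_real_derivative_powr[OF that])
      have "((\<lambda>u. u powr (- l / 2) * e u) has_real_derivative
          (- l / 2) * u powr (- l / 2 - 1) * e u +
          (deriv s (L u + 1) * (1 / (2 * u)) * s (real m + 1 - L u) +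
           deriv s (real m + 1 - L u) * (- (1 / (2 * u))) * s (L u + 1)) * u powr (- l / 2)) (at u)"
        unfolding e_def by (rule DERIV_mult[OF D0 DERIV_mult[OF D1 D2]])
      then have "(g has_real_derivative
          (- l / 2) * u powr (- l / 2 - 1) * e u +
          (deriv s (L u + 1) * (1 / (2 * u)) * s (real m + 1 - L u) +
           deriv s (real m + 1 - L u) * (- (1 / (2 * u))) * s (L u + 1)) * u powr (- l / 2)) (at u)"
        by (rule has_field_derivative_transform_within_open[of _ _ _ "{0<..}"]) (use that in \<open>auto simp: g_def\<close>)
      moreover have "u powr (- l / 2 - 1) = u powr (- l / 2) / u"
        using that by (simp add: powr_diff)
      ultimately have "(g has_real_derivative
          (- l / 2) * (u powr (- l / 2) / u) * e u +
          (deriv s (L u + 1) * (1 / (2 * u)) * s (real m + 1 - L u) +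
           deriv s (real m + 1 - L u) * (- (1 / (2 * u))) * s (L u + 1)) * u powr (- l / 2)) (at u)"
        by (simp only:)
      from DERIV_unique[OF g' this] show ?thesis
        using that by (simp only:) (simp add: g_def field_simps)
    qed
    have "\<bar>2 * u * g' u + l * g u\<bar> \<le> 2 * K * u powr (- l / 2)" if "0 < u" for u
    proof -
      have "\<bar>deriv s (L u + 1) * s (real m + 1 - L u) - s (L u + 1) * deriv s (real m + 1 - L u)\<bar>
          \<le> \<bar>deriv s (L u + 1)\<bar> * s (real m + 1 - L u) + s (L u + 1) * \<bar>deriv s (real m + 1 - L u)\<bar>"
        by (rule order_trans[OF abs_triangle_ineq4]) (simp add: abs_mult s)
      also have "\<dots> \<le> K * 1 + 1 * K"
        by (intro add_mono mult_mono s s'(2) K) auto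
      finally show ?thesis
        unfolding key[OF that] abs_mult by (simp add: mult.commute[of _ "u powr _"] mult_left_mono)
    qed
    \<comment> \<open>In terms of L the excluded intervals are [-2, 1) and [m - 1, m + 2), one unit
      more on each side than the transition layers. The margin avoids the end points, where
      \<open>deriv s\<close> is not known to vanish, and both intervals have length 3.\<close>
    moreover have "2 * u * g' u + l * g u = 0" if "0 < u" "u \<notin> {exp (-4)..<exp 2}"
      "u \<notin> {exp (2 * (real m - 1))..<exp (2 * (real m + 2))}" for u
    proof -
      have "L u < -2 \<or> 1 \<le> L u" "L u < real m - 1 \<or> real m + 2 \<le> L u"
        using that L_le(2)[OF that(1), of "-2"] L_le(2)[OF that(1), of 1]
          L_le(2)[OF that(1), of "real m - 1"] L_le(2)[OF that(1), of "real m + 2"] by auto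
      then have "deriv s (L u + 1) = 0" "deriv s (real m + 1 - L u) = 0"
        by (auto intro!: s'(3))
      then show ?thesis using key[OF that(1)] by simp
    qed
    moreover have "0 \<le> g u \<and> g u \<le> u powr (- l / 2)" if "0 < u" for u
      using that s mult_left_le[of "e u" "u powr (- l / 2)"] by (simp add: g_def e_def mult_le_one)
    moreover have "g u = u powr (- l / 2)" if "1 \<le> u" "u \<le> exp (2 * real m)" for u
    proof -
      have "0 \<le> L u" "L u \<le> real m" using L_le[of u] that by (auto simp: L_def)
      then have "e u = 1" using s(4) by (simp add: e_def)
      then show ?thesis using that by (simp add: g_def)
    qed
    ultimately show "\<exists>g g'. (\<forall>k. Ck_on k g UNIV) \<and> (\<forall>u. (g has_real_derivative g' u) (at u)) \<and>
      (\<forall>u>0. 0 \<le> g u \<and> g u \<le> u powr (- l / 2)) \<and>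
      (\<forall>u. 1 \<le> u \<longrightarrow> u \<le> exp (2 * real m) \<longrightarrow> g u = u powr (- l / 2)) \<and>
      (\<forall>u. u \<le> exp (-2) \<or> exp (2 * (real m + 1)) \<le> u \<longrightarrow> g u = 0) \<and>
      (\<forall>u>0. \<bar>2 * u * g' u + l * g u\<bar> \<le> 2 * K * u powr (- l / 2)) \<and>
      (\<forall>u>0. u \<notin> {exp (-4)..<exp 2} \<longrightarrow> u \<notin> {exp (2 * (real m - 1))..<exp (2 * (real m + 2))} \<longrightarrow>
         2 * u * g' u + l * g u = 0)"
      using smooth g' g0 by (intro exI[of _ g] exI[of _ g'] conjI allI impI) simp_all
  qed
qed

text \<open>The parameters \<open>a\<close> and \<open>b\<close> bound ln |x'|, so that scaling x'
  becomes a translation of the interval; it is half-open so that consecutive shells are disjoint.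
  The powers R ^ \<sigma> j make the box in the other variables homogeneous under dilations.\<close>

definition shell :: "('n::finite \<Rightarrow> nat) \<Rightarrow> real \<Rightarrow> real \<Rightarrow> real \<Rightarrow> (real^'n) set" where
  "shell \<sigma> a b R = {x. horizontal_sq \<sigma> x \<in> {exp (2 * a)..<exp (2 * b)} \<and> (\<forall>j\<in>- first_stratum \<sigma>. \<bar>x $ j\<bar> \<le> R ^ \<sigma> j)}"

lemma compact_cylinder:
  "compact {x :: real^'n. horizontal_sq \<sigma> x \<le> c \<and> (\<forall>j\<in>- first_stratum \<sigma>. \<bar>x $ j\<bar> \<le> d j)}" (is "compact ?S")
proof -
  let ?c = "\<lambda>j. if j \<in> first_stratum \<sigma> then sqrt c else d j"
  have "?S \<subseteq> cbox (\<chi> j. - ?c j) (\<chi> j. ?c j)"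
  proof
    fix x assume x: "x \<in> ?S"
    have "\<bar>x $ j\<bar> \<le> ?c j" for j
    proof (cases "j \<in> first_stratum \<sigma>")
      case True
      have "(x $ j)\<^sup>2 \<le> horizontal_sq \<sigma> x"
        unfolding horizontal_sq_def using True member_le_sum[of j "first_stratum \<sigma>" "\<lambda>k. (x $ k)\<^sup>2"] by simp
      then have "(x $ j)\<^sup>2 \<le> c" using x by simp
      then have "\<bar>x $ j\<bar> \<le> sqrt c" using real_sqrt_le_mono[of "(x $ j)\<^sup>2" c] by simp
      then show ?thesis using True by simp
    qed (use x in auto)
    then show "x \<in> cbox (\<chi> j. - ?c j) (\<chi> j. ?c j)" by (simp add: mem_box_cart abs_le_iff minus_le_iff)
  qed
  then have "bounded ?S" by (rule bounded_subset[OF bounded_cbox])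
  moreover have "?S = {x. horizontal_sq \<sigma> x \<le> c} \<inter> (\<Inter>j\<in>- first_stratum \<sigma>. {x. \<bar>x $ j\<bar> \<le> d j})"
    by auto
  then have "closed ?S"
    by (simp only:) (intro closed_Int closed_INT ballI closed_Collect_le continuous_horizontal_sq continuous_intros)
  ultimately show ?thesis by (simp add: compact_eq_bounded_closed)
qed

lemma shell_Un:
  assumes "a \<le> b" "b \<le> c"
  shows "shell \<sigma> a c R = shell \<sigma> a b R \<union> shell \<sigma> b c R" "shell \<sigma> a b R \<inter> shell \<sigma> b c R = {}"
proof -
  have "{exp (2 * a)..<exp (2 * c)} = {exp (2 * a)..<exp (2 * b)} \<union> {exp (2 * b)..<exp (2 * c)}"
    using assms by (intro ivl_disj_un_two(3)[symmetric]) auto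
  then show "shell \<sigma> a c R = shell \<sigma> a b R \<union> shell \<sigma> b c R" unfolding shell_def by blast
  have "{exp (2 * a)..<exp (2 * b)} \<inter> {exp (2 * b)..<exp (2 * c)} = {}" by auto
  then show "shell \<sigma> a b R \<inter> shell \<sigma> b c R = {}" unfolding shell_def by blast
qed

lemma shell_measurable [measurable]:
  fixes \<sigma> :: "'n::finite \<Rightarrow> nat"
  shows "shell \<sigma> a b R \<in> sets borel"
proof -
  have [measurable]: "horizontal_sq \<sigma> \<in> borel_measurable borel"
    by (intro borel_measurable_continuous_onI continuous_horizontal_sq)
  have [measurable]: "(\<lambda>x::real^'n. x $ j) \<in> borel_measurable borel" for j :: 'n
    by (intro borel_measurable_continuous_onI continuous_intros)
  show ?thesis unfolding shell_def by measurable
qed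

text \<open>This is |x'| powr (-N). For the profile |x'| powr (-l) it equals the p-th power times
  the weight |x'| powr (- \<alpha> p), because l p + \<alpha> p = N.\<close>

definition shell_weight :: "('n::finite \<Rightarrow> nat) \<Rightarrow> real^'n \<Rightarrow> real" where
  "shell_weight \<sigma> x = horizontal_sq \<sigma> x powr (- real (card (first_stratum \<sigma>)) / 2)"

lemma shell_weight_nonneg: "0 \<le> shell_weight \<sigma> x"
  by (simp add: shell_weight_def)

lemma shell_weight_measurable [measurable]: "shell_weight \<sigma> \<in> borel_measurable borel"
proof -
  have [measurable]: "horizontal_sq \<sigma> \<in> borel_measurable borel"
    by (intro borel_measurable_continuous_onI continuous_horizontal_sq)
  show ?thesis unfolding shell_weight_def[abs_def] by measurable
qed

definition shell_mass :: "('n::finite \<Rightarrow> nat) \<Rightarrow> real \<Rightarrow> real \<Rightarrow> real \<Rightarrow> ennreal" where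
  "shell_mass \<sigma> a b R = (\<integral>\<^sup>+x. ennreal (shell_weight \<sigma> x * indicator (shell \<sigma> a b R) x) \<partial>lborel)"

text \<open>Substitute exp t times x' and \<rho> ^ \<sigma> j times the other coordinates. The
  Jacobian contributes exp (t N), which the weight cancels, and a power of \<rho>. The two scalings
  are independent, since only Lebesgue measure and not the group law is involved.\<close>

lemma shell_mass_scale:
  fixes \<sigma> :: "'n::finite \<Rightarrow> nat"
  assumes "0 < \<rho>"
  shows "shell_mass \<sigma> (a + t) (b + t) (\<rho> * R) = ennreal (\<rho> ^ (\<Sum>j\<in>- first_stratum \<sigma>. \<sigma> j)) * shell_mass \<sigma> a b R"
proof -
  let ?F = "first_stratum \<sigma>" and ?N = "real (card (first_stratum \<sigma>))"
  define c where "c i = (if i \<in> ?F then exp t else \<rho> ^ \<sigma> i)" for i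
  let ?T = "\<lambda>x::real^'n. \<chi> i. c i * x $ i"
  have sq: "horizontal_sq \<sigma> (?T x) = exp (2 * t) * horizontal_sq \<sigma> x" for x
    by (simp add: horizontal_sq_def c_def power_mult_distrib sum_distrib_left exp_double)
  have w: "shell_weight \<sigma> (?T x) = exp (- t * ?N) * shell_weight \<sigma> x" for x
    by (simp add: shell_weight_def sq powr_mult horizontal_sq_nonneg exp_powr_real)
  have mem: "?T x \<in> shell \<sigma> (a + t) (b + t) (\<rho> * R) \<longleftrightarrow> x \<in> shell \<sigma> a b R" for x
  proof -
    have "exp (2 * (a + t)) = exp (2 * t) * exp (2 * a)" for a
      by (simp add: exp_add distrib_left mult.commute)
    moreover have "\<bar>\<rho> ^ \<sigma> j * x $ j\<bar> \<le> (\<rho> * R) ^ \<sigma> j \<longleftrightarrow> \<bar>x $ j\<bar> \<le> R ^ \<sigma> j" for j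
      using assms by (simp add: abs_mult power_mult_distrib)
    then have "(\<forall>j\<in>- ?F. \<bar>c j * x $ j\<bar> \<le> (\<rho> * R) ^ \<sigma> j) \<longleftrightarrow> (\<forall>j\<in>- ?F. \<bar>x $ j\<bar> \<le> R ^ \<sigma> j)"
      by (intro ball_cong refl) (simp add: c_def)
    ultimately show ?thesis by (simp add: shell_def sq)
  qed
  have "prod c UNIV = prod c ?F * prod c (- ?F)"
    by (subst prod.union_disjoint[symmetric]) auto
  also have "\<dots> = exp (t * ?N) * \<rho> ^ (\<Sum>j\<in>- ?F. \<sigma> j)"
    by (simp add: c_def power_sum exp_of_nat_mult[symmetric] mult.commute)
  finally have P: "prod c UNIV = exp (t * ?N) * \<rho> ^ (\<Sum>j\<in>- ?F. \<sigma> j)" .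
  have "shell_mass \<sigma> (a + t) (b + t) (\<rho> * R) = ennreal (prod c UNIV) *
      (\<integral>\<^sup>+x. ennreal (shell_weight \<sigma> (?T x) * indicator (shell \<sigma> (a + t) (b + t) (\<rho> * R)) (?T x)) \<partial>lborel)"
    unfolding shell_mass_def by (rule nn_integral_lborel_diagonal) (use assms in \<open>auto simp: c_def\<close>)
  also have "\<dots> = ennreal (prod c UNIV) *
      (\<integral>\<^sup>+x. ennreal (exp (- t * ?N)) * ennreal (shell_weight \<sigma> x * indicator (shell \<sigma> a b R) x) \<partial>lborel)"
    by (simp add: w mem indicator_def ennreal_mult'[symmetric] mult.assoc cong: if_cong)
  also have "\<dots> = ennreal (prod c UNIV) * (ennreal (exp (- t * ?N)) * shell_mass \<sigma> a b R)"
    unfolding shell_mass_def by (subst nn_integral_cmult) auto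
  also have "\<dots> = ennreal (prod c UNIV * exp (- t * ?N)) * shell_mass \<sigma> a b R"
    using assms by (simp add: ennreal_mult P mult.assoc)
  also have "prod c UNIV * exp (- t * ?N) = \<rho> ^ (\<Sum>j\<in>- ?F. \<sigma> j)"
    by (simp add: P exp_minus field_simps)
  finally show ?thesis .
qed

text \<open>Consecutive unit shells have equal mass by \<open>shell_mass_scale\<close> with \<rho> =
  1. This is the logarithmic divergence of the integral of |x'| powr (-N), and the source of the
  linear growth in \<open>m\<close>.\<close>

lemma shell_mass_nat: "shell_mass \<sigma> a (a + real m) R = of_nat m * shell_mass \<sigma> 0 1 R"
proof (induction m)
  case 0
  then show ?case by (simp add: shell_mass_def shell_def)
next
  case (Suc m)
  have "(indicator (shell \<sigma> a (a + real (Suc m)) R) x :: real) =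
      indicator (shell \<sigma> a (a + real m) R) x + indicator (shell \<sigma> (a + real m) (a + real (Suc m)) R) x" for x
    using shell_Un[of a "a + real m" "a + real (Suc m)" \<sigma> R] by (simp add: indicator_disj_union)
  then have "ennreal (shell_weight \<sigma> x * indicator (shell \<sigma> a (a + real (Suc m)) R) x) =
      ennreal (shell_weight \<sigma> x * indicator (shell \<sigma> a (a + real m) R) x) +
      ennreal (shell_weight \<sigma> x * indicator (shell \<sigma> (a + real m) (a + real (Suc m)) R) x)" for x
    by (simp add: distrib_left shell_weight_nonneg)
  then have "shell_mass \<sigma> a (a + real (Suc m)) R = shell_mass \<sigma> a (a + real m) R + shell_mass \<sigma> (a + real m) (a + real (Suc m)) R"
    unfolding shell_mass_def by (simp only:) (subst nn_integral_add; simp)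
  also have "\<dots> = shell_mass \<sigma> a (a + real m) R + shell_mass \<sigma> 0 1 R"
    using shell_mass_scale[of 1 \<sigma> 0 "a + real m" 1 R] by (simp add: add_ac)
  also have "\<dots> = of_nat (Suc m) * shell_mass \<sigma> 0 1 R"
    unfolding Suc.IH by (simp only: of_nat_Suc distrib_right mult_1 add.commute)
  finally show ?case .
qed

text \<open>The shell is bounded and the weight is at most 1 on it, because |x'| is at least 1. It
  contains a nonempty open set \<open>U\<close> on which the weight is at least exp (-N).\<close>

lemma shell_mass_finite_pos:
  fixes \<sigma> :: "'n::finite \<Rightarrow> nat"
  assumes "0 < R" "first_stratum \<sigma> \<noteq> {}"
  shows "shell_mass \<sigma> 0 1 R < \<infinity>" "0 < shell_mass \<sigma> 0 1 R"
proof -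
  let ?S = "shell \<sigma> 0 1 R" and ?N = "real (card (first_stratum \<sigma>))"
  have "?S \<subseteq> {x. horizontal_sq \<sigma> x \<le> exp 2 \<and> (\<forall>j\<in>- first_stratum \<sigma>. \<bar>x $ j\<bar> \<le> R ^ \<sigma> j)}"
    by (auto simp: shell_def)
  then have b: "bounded ?S" by (rule bounded_subset[OF compact_imp_bounded[OF compact_cylinder]])
  have "shell_mass \<sigma> 0 1 R \<le> (\<integral>\<^sup>+x. indicator ?S x \<partial>lborel)"
    unfolding shell_mass_def
  proof (rule nn_integral_mono)
    fix x
    show "ennreal (shell_weight \<sigma> x * indicator ?S x) \<le> indicator ?S x"
      using powr_mono[of "- ?N / 2" 0 "horizontal_sq \<sigma> x"]
      by (auto simp: indicator_def shell_def shell_weight_def split: if_splits)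
  qed
  also have "\<dots> = emeasure lborel ?S" by simp
  also have "\<dots> < \<infinity>" using emeasure_bounded_finite[OF b] .
  finally show "shell_mass \<sigma> 0 1 R < \<infinity>" .
  define U where "U = {x :: real^'n. 1 < horizontal_sq \<sigma> x \<and> horizontal_sq \<sigma> x < exp 2 \<and> (\<forall>j\<in>- first_stratum \<sigma>. \<bar>x $ j\<bar> < R ^ \<sigma> j)}"
  have "U = {x. 1 < horizontal_sq \<sigma> x} \<inter> {x. horizontal_sq \<sigma> x < exp 2}
      \<inter> (\<Inter>j\<in>- first_stratum \<sigma>. {x. \<bar>x $ j\<bar> < R ^ \<sigma> j})"
    by (auto simp: U_def)
  then have "open U"
    by (simp only:) (intro open_Int open_INT finite ballI open_Collect_less continuous_horizontal_sq continuous_intros)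
  moreover have "U \<noteq> {}"
  proof -
    obtain k where k: "k \<in> first_stratum \<sigma>" using assms(2) by blast
    \<comment> \<open>The length 3 / 2 lies strictly between the radii 1 and e of the unit
      shell.\<close>
    have "horizontal_sq \<sigma> (axis k (3 / 2)) = (\<Sum>j\<in>first_stratum \<sigma>. if j = k then 9 / 4 else 0)"
      unfolding horizontal_sq_def by (rule sum.cong) (auto simp: axis_def power2_eq_square)
    then have "horizontal_sq \<sigma> (axis k (3 / 2)) = 9 / 4" using k by simp
    moreover have "9 / 4 < exp (2::real)" using exp_ge_add_one_self[of 2] by linarith
    moreover have "(axis k (3 / 2) :: real^'n) $ j = 0" if "j \<in> - first_stratum \<sigma>" for j
      using that k by (auto simp: axis_def)
    ultimately have "axis k (3 / 2) \<in> U" using assms(1) by (simp add: U_def)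
    then show ?thesis by blast
  qed
  ultimately have "\<not> negligible U" by (rule open_not_negligible)
  moreover have Ub: "U \<in> sets lborel" using \<open>open U\<close> by simp
  ultimately have "emeasure lborel U \<noteq> 0"
    using null_sets_completionI[of U lborel] by (auto simp: negligible_iff_null_sets null_sets_def)
  then have "0 < ennreal (exp (- ?N)) * emeasure lborel U"
    by (simp add: ennreal_zero_less_mult_iff zero_less_iff_neq_zero)
  also have "\<dots> = (\<integral>\<^sup>+x. ennreal (exp (- ?N)) * indicator U x \<partial>lborel)"
    using Ub by (simp add: nn_integral_cmult_indicator)
  also have "\<dots> \<le> shell_mass \<sigma> 0 1 R"
    unfolding shell_mass_def
  proof (rule nn_integral_mono)
    fix x
    show "ennreal (exp (- ?N)) * indicator U x \<le> ennreal (shell_weight \<sigma> x * indicator ?S x)"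
    proof (cases "x \<in> U")
      case True
      then have "x \<in> ?S" by (auto simp: U_def shell_def intro: less_imp_le)
      moreover have "exp 2 powr (- ?N / 2) \<le> shell_weight \<sigma> x"
        using True powr_mono2'[of "- ?N / 2" "horizontal_sq \<sigma> x" "exp 2"]
        by (simp add: U_def shell_weight_def)
      ultimately show ?thesis using True by (simp add: exp_powr_real ennreal_leI)
    qed simp
  qed
  finally show "0 < shell_mass \<sigma> 0 1 R" .
qed

text \<open>The boxes of size \<open>R\<close> and \<open>2 * R\<close> are measured by the same
  \<open>A\<close>. The functions are bounded below on the former and their errors live on the
  latter, and the ratio of the masses does not depend on \<open>R\<close>.\<close>

lemma shell_integral:
  fixes \<sigma> :: "'n::finite \<Rightarrow> nat"
  assumes "0 < R" "first_stratum \<sigma> \<noteq> {}"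
  obtains A where "0 < A"
    "\<And>a m. integrable lborel (\<lambda>x. shell_weight \<sigma> x * indicator (shell \<sigma> a (a + real m) R) x)"
    "\<And>a m. (\<integral>x. shell_weight \<sigma> x * indicator (shell \<sigma> a (a + real m) R) x \<partial>lborel) = real m * A"
    "\<And>a m. integrable lborel (\<lambda>x. shell_weight \<sigma> x * indicator (shell \<sigma> a (a + real m) (2 * R)) x)"
    "\<And>a m. (\<integral>x. shell_weight \<sigma> x * indicator (shell \<sigma> a (a + real m) (2 * R)) x \<partial>lborel)
       = 2 ^ (\<Sum>j\<in>- first_stratum \<sigma>. \<sigma> j) * (real m * A)"
proof -
  let ?Q = "\<Sum>j\<in>- first_stratum \<sigma>. \<sigma> j"
  define A where "A = enn2real (shell_mass \<sigma> 0 1 R)"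
  have A: "shell_mass \<sigma> 0 1 R = ennreal A" "0 < A"
    using shell_mass_finite_pos[OF assms] by (auto simp: A_def enn2real_positive_iff)
  have 1: "shell_mass \<sigma> a (a + real m) R = ennreal (real m * A)" for a m
    using A by (simp add: shell_mass_nat ennreal_of_nat_eq_real_of_nat ennreal_mult)
  have 2: "shell_mass \<sigma> a (a + real m) (2 * R) = ennreal (2 ^ ?Q * (real m * A))" for a m
    using shell_mass_scale[of 2 \<sigma> a 0 "a + real m" R] A 1 by (simp add: ennreal_mult)
  have *: "integrable lborel (\<lambda>x. shell_weight \<sigma> x * indicator (shell \<sigma> a b r) x) \<and>
      (\<integral>x. shell_weight \<sigma> x * indicator (shell \<sigma> a b r) x \<partial>lborel) = c"
    if "shell_mass \<sigma> a b r = ennreal c" "0 \<le> c" for a b r c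
    using that unfolding shell_mass_def
    by (subst (asm) nn_integral_eq_integrable) (auto simp: shell_weight_nonneg)
  show thesis
    using *[OF 1] *[OF 2] A(2) by (intro that[of A]) auto
qed

section \<open>Sharpness of the constant\<close>

lemma split_constant_exists:
  fixes B C p :: real
  assumes "0 \<le> B" "B < C"
  obtains \<tau> where "0 < \<tau>" "\<tau> < 1" "(1 - \<tau>) powr (1 - p) * B < C"
proof -
  have "((\<lambda>\<tau>. (1 - \<tau>) powr (1 - p) * B) \<longlongrightarrow> (1 - 0) powr (1 - p) * B) (at_right 0)"
    by (intro tendsto_intros) auto
  then have "\<forall>\<^sub>F \<tau> in at_right 0. (1 - \<tau>) powr (1 - p) * B < C"
    using assms by (intro order_tendstoD(2)) auto
  moreover have "\<forall>\<^sub>F \<tau> in at_right (0::real). 0 < \<tau> \<and> \<tau> < 1"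
    by (auto simp: eventually_at_right_field intro: exI[of _ 1])
  ultimately have "\<forall>\<^sub>F \<tau> in at_right 0. 0 < \<tau> \<and> \<tau> < 1 \<and> (1 - \<tau>) powr (1 - p) * B < C"
    by eventually_elim simp
  then show thesis using that eventually_happens trivial_limit_at_right_real by blast
qed

context stratified_group
begin

text \<open>The three terms of the error bound are the inner layer, the outer layer, and the cut-off
  in the remaining variables. The last one acts on all m + 3 unit shells of the support region, and
  its factor K / m makes its total comparable to the two layers of fixed length. \<open>K\<close> is
  obtained before \<open>m\<close>, whereas \<open>R\<close> depends on \<open>m\<close>.\<close>

lemma near_extremal_exists:
  fixes \<alpha> p l :: real
  defines "l \<equiv> (real (card (first_stratum \<sigma>)) - \<alpha> * p) / p"
  assumes p: "1 < p"
  obtains K where "0 \<le> K"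
    "\<And>m. 1 \<le> m \<Longrightarrow> \<exists>F E R. 0 < R \<and> (\<lambda>x. complex_of_real (F x)) \<in> test_functions (horizontal_nonzero \<sigma>) \<and>
      (\<forall>x. indicator (shell \<sigma> 0 (real m) R) x * shell_weight \<sigma> x
           \<le> \<bar>F x\<bar> powr p * horizontal_sq \<sigma> x powr (- \<alpha> * p / 2)) \<and>
      (\<forall>x. horizontal_radial \<sigma> X (\<lambda>x. complex_of_real (F x)) x = complex_of_real (- l * F x + E x)) \<and>
      (\<forall>x. \<bar>E x\<bar> powr p * horizontal_sq \<sigma> x powr (- \<alpha> * p / 2) \<le> shell_weight \<sigma> x *
         (K * indicator (shell \<sigma> (- 2) 1 (2 * R)) x + K * indicator (shell \<sigma> (real m - 1) (real m + 2) (2 * R)) x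
          + K / real m * indicator (shell \<sigma> (- 1) (real m + 2) (2 * R)) x))"
proof -
  let ?F = "first_stratum \<sigma>"
  obtain K0 where K0: "0 \<le> K0" and trunc: "\<And>m. \<exists>g g'. (\<forall>k. Ck_on k g UNIV) \<and> (\<forall>u. (g has_real_derivative g' u) (at u)) \<and>
      (\<forall>u>0. 0 \<le> g u \<and> g u \<le> u powr (- l / 2)) \<and>
      (\<forall>u. 1 \<le> u \<longrightarrow> u \<le> exp (2 * real m) \<longrightarrow> g u = u powr (- l / 2)) \<and>
      (\<forall>u. u \<le> exp (-2) \<or> exp (2 * (real m + 1)) \<le> u \<longrightarrow> g u = 0) \<and>
      (\<forall>u>0. \<bar>2 * u * g' u + l * g u\<bar> \<le> K0 * u powr (- l / 2)) \<and>
      (\<forall>u>0. u \<notin> {exp (-4)..<exp 2} \<longrightarrow> u \<notin> {exp (2 * (real m - 1))..<exp (2 * (real m + 2))} \<longrightarrow>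
         2 * u * g' u + l * g u = 0)"
    by (rule truncated_power_exists[of l]) blast
  obtain P :: "real^'n \<Rightarrow> real" where P: "\<And>k. Ck_on k P UNIV" "\<And>y. 0 \<le> P y" "\<And>y. P y \<le> 1"
    "\<And>y. (\<And>j. j \<in> - ?F \<Longrightarrow> \<bar>y $ j\<bar> \<le> 1) \<Longrightarrow> P y = 1"
    "\<And>y j. j \<in> - ?F \<Longrightarrow> 2 \<le> \<bar>y $ j\<bar> \<Longrightarrow> P y = 0"
    by (rule smooth_box_cutoff_exists[of "- ?F"]) blast
  let ?DP = "\<lambda>y. frechet_derivative P (at y)"
  have DP: "(P has_derivative ?DP y) (at y)" for y using Ck_on_SucD(1)[OF P(1)] by blast
  have DP_cont: "continuous_on UNIV (\<lambda>y. ?DP y v)" for v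
    using Ck_on_SucD(2)[OF P(1)[of "Suc 0"]] by simp
  have DP_far: "?DP y v = 0" if "j \<in> - ?F" "2 < \<bar>y $ j\<bar>" for y v j
  proof -
    have "open {y :: real^'n. 2 < \<bar>y $ j\<bar>}" by (intro open_Collect_less continuous_intros)
    moreover have "0 = P y" if "y \<in> {y. 2 < \<bar>y $ j\<bar>}" for y
      using P(5)[OF \<open>j \<in> - ?F\<close>, of y] that by simp
    ultimately have "(P has_derivative (\<lambda>_. 0)) (at y)"
      using has_derivative_transform_within_open[OF has_derivative_const, of _ y 0 P] that(2) by blast
    then show ?thesis using frechet_derivative_at by metis
  qed
  \<comment> \<open>\<open>K0\<close> controls the transition layers and 1 the other cut-off; 3 powr
    p comes from estimating the sum of the two errors by three times their maximum before taking the
    p-th power.\<close>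
  define K where "K = 3 powr p * (K0 powr p + 1)"
  show thesis
  proof (rule that[of K])
    show "0 \<le> K" by (simp add: K_def)
    fix m :: nat assume m: "1 \<le> m"
    obtain g g' where g: "\<And>k. Ck_on k g UNIV" "\<And>u. (g has_real_derivative g' u) (at u)"
      "\<And>u. 0 < u \<Longrightarrow> 0 \<le> g u" "\<And>u. 0 < u \<Longrightarrow> g u \<le> u powr (- l / 2)"
      "\<And>u. 1 \<le> u \<Longrightarrow> u \<le> exp (2 * real m) \<Longrightarrow> g u = u powr (- l / 2)"
      "\<And>u. u \<le> exp (-2) \<or> exp (2 * (real m + 1)) \<le> u \<Longrightarrow> g u = 0"
      "\<And>u. 0 < u \<Longrightarrow> \<bar>2 * u * g' u + l * g u\<bar> \<le> K0 * u powr (- l / 2)"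
      "\<And>u. 0 < u \<Longrightarrow> u \<notin> {exp (-4)..<exp 2} \<Longrightarrow> u \<notin> {exp (2 * (real m - 1))..<exp (2 * (real m + 2))} \<Longrightarrow>
         2 * u * g' u + l * g u = 0"
      using trunc[of m] by blast
    \<comment> \<open>For every R with R \<ge> 1 the error \<open>E2 x\<close> below vanishes unless
      the point dilated by 1 / R lies in \<open>T\<close>: the dilation does not increase |x'|, and
      the derivative of \<open>P\<close> is 0 where some coordinate outside the first stratum
      exceeds 2. The bound \<open>M\<close> on \<open>T\<close> thus depends on \<open>m\<close> but
      not on \<open>R\<close>, and \<open>R\<close> can be chosen from it.\<close>
    define T where "T = {y :: real^'n. horizontal_sq \<sigma> y \<le> exp (2 * (real m + 1)) \<and> (\<forall>j\<in>- ?F. \<bar>y $ j\<bar> \<le> 2)}"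
    define \<Theta> where "\<Theta> y = (\<Sum>k\<in>?F. \<bar>?DP y (X k y)\<bar>)" for y
    have "?DP y (X k y) = (\<Sum>j\<in>UNIV. X k y $ j * ?DP y (axis j 1))" for y k
    proof -
      have lin: "linear (?DP y)" using DP has_derivative_linear by blast
      have "(\<Sum>j\<in>UNIV. X k y $ j *\<^sub>R axis j 1) = X k y"
        by (simp add: vec_eq_iff axis_def if_distrib cong: if_cong)
      from arg_cong[OF this, of "?DP y"] show ?thesis
        by (simp add: linear_sum[OF lin] linear_cmul[OF lin])
    qed
    then have "continuous_on UNIV \<Theta>"
      unfolding \<Theta>_def by simp (intro continuous_intros DP_cont horizontal_field_Ck[of _ 0, simplified])
    then have "bounded (\<Theta> ` T)"
      unfolding T_def
      by (intro compact_imp_bounded compact_continuous_image compact_cylinder) (rule continuous_on_subset, auto)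
    then obtain M where "\<forall>y\<in>T. norm (\<Theta> y) \<le> M" by (auto simp: bounded_iff)
    then have M: "\<Theta> y \<le> M" if "y \<in> T" for y using that by fastforce
    have "0 \<in> T" by (simp add: T_def horizontal_sq_def)
    have "0 \<le> \<Theta> 0" by (simp add: \<Theta>_def sum_nonneg)
    with M[OF \<open>0 \<in> T\<close>] have M0: "0 \<le> M" by linarith
    \<comment> \<open>On the support of the profile |x'| is at most exp (m + 1), and dilation by 1 /
      R divides it by R. So the derivative of \<open>P\<close> along Z is at most exp (m + 1) / R *
      M, which this choice brings below 1 / m.\<close>
    define R where "R = max 1 (exp (real m + 1) * M * real m)"
    have R: "1 \<le> R" "exp (real m + 1) * M * real m \<le> R" by (auto simp: R_def)
    let ?d = "dilation \<sigma> (1 / R)"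
    have d_nth: "?d x $ j = x $ j / R ^ \<sigma> j" for x j
      by (simp add: dilation_def power_one_over field_simps)
    define F where "F x = g (horizontal_sq \<sigma> x) * P (?d x)" for x
    define E1 where "E1 x = (2 * horizontal_sq \<sigma> x * g' (horizontal_sq \<sigma> x) + l * g (horizontal_sq \<sigma> x)) * P (?d x)" for x
    define E2 where "E2 x = g (horizontal_sq \<sigma> x) * ?DP (?d x) (radial_field \<sigma> X (?d x))" for x
    have P_outside: "P (?d x) = 0" "?DP (?d x) v = 0" if "x \<notin> S" "\<And>x. (\<forall>j\<in>- ?F. \<bar>x $ j\<bar> \<le> (2 * R) ^ \<sigma> j) \<Longrightarrow> x \<in> S" for x v S
    proof -
      have "\<not> (\<forall>j\<in>- ?F. \<bar>x $ j\<bar> \<le> (2 * R) ^ \<sigma> j)" using that by blast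
      then obtain j where j: "j \<in> - ?F" "(2 * R) ^ \<sigma> j < \<bar>x $ j\<bar>" by (auto simp: not_le)
      have "2 * R ^ \<sigma> j \<le> (2 * R) ^ \<sigma> j"
        using R(1) self_le_power[of "2::real" "\<sigma> j"] stratum_pos[of j] by (simp add: power_mult_distrib)
      then have "2 * R ^ \<sigma> j < \<bar>x $ j\<bar>" using j(2) by linarith
      then have gt: "2 < \<bar>?d x $ j\<bar>" using R(1) by (simp add: d_nth field_simps)
      then show "P (?d x) = 0" using P(5) j(1) by (meson less_imp_le)
      show "?DP (?d x) v = 0" by (rule DP_far[OF j(1) gt])
    qed
    have F_der: "(F has_derivative (\<lambda>w. g (horizontal_sq \<sigma> x) * ?DP (?d x) (?d w) +
        g' (horizontal_sq \<sigma> x) * (2 * (\<Sum>k\<in>?F. x $ k * w $ k)) * P (?d x))) (at x)" for x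
    proof -
      have 1: "((\<lambda>x. g (horizontal_sq \<sigma> x)) has_derivative (\<lambda>w. g' (horizontal_sq \<sigma> x) * (2 * (\<Sum>k\<in>?F. x $ k * w $ k)))) (at x)"
        by (rule has_derivative_compose[OF horizontal_sq_has_derivative g(2)[unfolded has_field_derivative_def]])
      have 2: "((\<lambda>x. P (?d x)) has_derivative (\<lambda>w. ?DP (?d x) (?d w))) (at x)"
        by (rule has_derivative_compose[OF bounded_linear_imp_has_derivative[OF bounded_linear_dilation] DP])
      show ?thesis unfolding F_def by (rule has_derivative_mult[OF 1 2])
    qed
    have "horizontal_radial \<sigma> X (\<lambda>x. complex_of_real (F x)) x = complex_of_real (- l * F x + (E1 x + E2 x))" for x
    proof -
      have der: "((\<lambda>x. complex_of_real (F x)) has_derivative (\<lambda>w. complex_of_real (g (horizontal_sq \<sigma> x) * ?DP (?d x) (?d w) +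
        g' (horizontal_sq \<sigma> x) * (2 * (\<Sum>k\<in>?F. x $ k * w $ k)) * P (?d x)))) (at x)"
        by (rule bounded_linear.has_derivative[OF bounded_linear_of_real F_der])
      have "(\<Sum>k\<in>?F. x $ k * radial_field \<sigma> X x $ k) = horizontal_sq \<sigma> x"
        by (simp add: radial_field_first_stratum horizontal_sq_def power2_eq_square)
      moreover have "?d (radial_field \<sigma> X x) = radial_field \<sigma> X (?d x)"
        using R(1) by (intro radial_field_dilation) simp
      moreover have "horizontal_radial \<sigma> X (\<lambda>x. complex_of_real (F x)) x
          = frechet_derivative (\<lambda>x. complex_of_real (F x)) (at x) (radial_field \<sigma> X x)"
        by (rule horizontal_radial_eq) (use der in \<open>auto simp: differentiable_def\<close>)
      ultimately show ?thesis
        unfolding frechet_derivative_at[OF der, symmetric]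
        by (simp only:) (simp add: F_def E1_def E2_def algebra_simps)
    qed
    moreover have "(\<lambda>x. complex_of_real (F x)) \<in> test_functions (horizontal_nonzero \<sigma>)"
    proof -
      let ?C = "{x. exp (-2) \<le> horizontal_sq \<sigma> x} \<inter>
        {x. horizontal_sq \<sigma> x \<le> exp (2 * (real m + 1)) \<and> (\<forall>j\<in>- ?F. \<bar>x $ j\<bar> \<le> (2 * R) ^ \<sigma> j)}"
      have sm: "Ck_on k (\<lambda>x. complex_of_real (F x)) UNIV" for k
      proof (rule Ck_on_bounded_linear[OF open_UNIV bounded_linear_of_real])
        have "Ck_on k (horizontal_sq \<sigma>) UNIV"
          unfolding horizontal_sq_def[abs_def] power2_eq_square
          by (intro Ck_on_sum Ck_on_mult open_UNIV Ck_on_linear[OF open_UNIV bounded_linear_vec_nth])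
        then have "Ck_on k (\<lambda>x. g (horizontal_sq \<sigma> x)) UNIV"
          by (rule Ck_on_compose[OF open_UNIV subset_UNIV _ g(1)])
        then show "Ck_on k F UNIV"
          unfolding F_def by (intro Ck_on_mult open_UNIV Ck_on_compose_linear[OF bounded_linear_dilation] P(1))
      qed
      have C: "compact ?C"
        by (intro closed_Int_compact compact_cylinder closed_Collect_le continuous_horizontal_sq continuous_intros)
      have "F x = 0" if "x \<notin> ?C" for x
      proof (cases "\<forall>j\<in>- ?F. \<bar>x $ j\<bar> \<le> (2 * R) ^ \<sigma> j")
        case True
        then have "g (horizontal_sq \<sigma> x) = 0" using that by (intro g(6)) auto
        then show ?thesis by (simp add: F_def)
      next
        case False
        then show ?thesis using P_outside(1)[of x "{x. \<forall>j\<in>- ?F. \<bar>x $ j\<bar> \<le> (2 * R) ^ \<sigma> j}"]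
          by (simp add: F_def)
      qed
      then have "{x. complex_of_real (F x) \<noteq> 0} \<subseteq> ?C" by auto
      then have cl: "closure {x. complex_of_real (F x) \<noteq> 0} \<subseteq> ?C"
        by (rule closure_minimal) (rule compact_imp_closed[OF C])
      have "compact (closure {x. complex_of_real (F x) \<noteq> 0})"
        using bounded_subset[OF compact_imp_bounded[OF C] cl] by (simp add: compact_eq_bounded_closed)
      moreover have "?C \<subseteq> horizontal_nonzero \<sigma>"
        by (auto simp: horizontal_nonzero_iff intro: less_le_trans[OF exp_gt_zero])
      ultimately show ?thesis
        using sm order_trans[OF cl] by (simp add: test_functions_def smooth_on_def)
    qed
    moreover have "indicator (shell \<sigma> 0 (real m) R) x * shell_weight \<sigma> x
        \<le> \<bar>F x\<bar> powr p * horizontal_sq \<sigma> x powr (- \<alpha> * p / 2)" for x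
    proof (cases "x \<in> shell \<sigma> 0 (real m) R")
      case True
      then have u: "1 \<le> horizontal_sq \<sigma> x" "horizontal_sq \<sigma> x \<le> exp (2 * real m)"
        by (auto simp: shell_def)
      have "P (?d x) = 1"
        using True R(1) by (intro P(4)) (auto simp: shell_def d_nth)
      then have "F x = horizontal_sq \<sigma> x powr (- l / 2)" using g(5)[OF u] by (simp add: F_def)
      then have "\<bar>F x\<bar> powr p * horizontal_sq \<sigma> x powr (- \<alpha> * p / 2) = horizontal_sq \<sigma> x powr (- l / 2 * p + - \<alpha> * p / 2)"
        by (simp only: abs_of_nonneg[OF powr_ge_zero] powr_powr powr_add)
      also have "- l / 2 * p + - \<alpha> * p / 2 = - real (card ?F) / 2"
        using p by (simp add: l_def field_simps)
      finally show ?thesis using True by (simp add: shell_weight_def)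
    qed simp
    moreover have "\<bar>E1 x + E2 x\<bar> powr p * horizontal_sq \<sigma> x powr (- \<alpha> * p / 2) \<le> shell_weight \<sigma> x *
         (K * indicator (shell \<sigma> (- 2) 1 (2 * R)) x + K * indicator (shell \<sigma> (real m - 1) (real m + 2) (2 * R)) x
          + K / real m * indicator (shell \<sigma> (- 1) (real m + 2) (2 * R)) x)" (is "?l \<le> _ * ?r") for x
    proof (cases "0 < horizontal_sq \<sigma> x \<and> (\<forall>j\<in>- ?F. \<bar>x $ j\<bar> \<le> (2 * R) ^ \<sigma> j)")
      case False
      show ?thesis
      proof (cases "0 < horizontal_sq \<sigma> x")
        case True
        then have "E1 x = 0" "E2 x = 0"
          using False P_outside[of x "{x. \<forall>j\<in>- ?F. \<bar>x $ j\<bar> \<le> (2 * R) ^ \<sigma> j}"] by (auto simp: E1_def E2_def)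
        then show ?thesis using p \<open>0 \<le> K\<close> by (simp add: shell_weight_nonneg)
      next
        case False
        then have "horizontal_sq \<sigma> x = 0" using horizontal_sq_nonneg[of \<sigma> x] by linarith
        then show ?thesis by (simp add: shell_weight_def)
      qed
    next
      case True
      define u where "u = horizontal_sq \<sigma> x"
      have u: "0 < u" using True by (simp add: u_def)
      define w where "w = u powr (- l / 2)"
      define i1 i2 i3 :: real where "i1 = indicator (shell \<sigma> (- 2) 1 (2 * R)) x"
        and "i2 = indicator (shell \<sigma> (real m - 1) (real m + 2) (2 * R)) x"
        and "i3 = indicator (shell \<sigma> (- 1) (real m + 2) (2 * R)) x"
      have mem: "x \<in> shell \<sigma> a b (2 * R) \<longleftrightarrow> u \<in> {exp (2 * a)..<exp (2 * b)}" for a b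
        using True by (simp add: shell_def u_def)
      have e1: "\<bar>E1 x\<bar> \<le> K0 * w * max i1 i2"
      proof (cases "i1 = 1 \<or> i2 = 1")
        case True
        then have "max i1 i2 = 1" by (auto simp: i1_def i2_def indicator_def)
        moreover have "\<bar>E1 x\<bar> \<le> K0 * w * 1"
          unfolding E1_def abs_mult u_def[symmetric] w_def
          by (intro mult_mono g(7) u) (use P(2,3) K0 in auto)
        ultimately show ?thesis by simp
      next
        case False
        then have "x \<notin> shell \<sigma> (- 2) 1 (2 * R)" "x \<notin> shell \<sigma> (real m - 1) (real m + 2) (2 * R)"
          by (auto simp: i1_def i2_def)
        then have "2 * u * g' u + l * g u = 0" using u by (intro g(8)) (auto simp: mem)
        moreover have "i1 = 0" "i2 = 0" using False by (auto simp: i1_def i2_def indicator_def split: if_splits)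
        ultimately show ?thesis by (simp add: E1_def u_def)
      qed
      have e2: "\<bar>E2 x\<bar> \<le> 1 / real m * w * i3"
      proof (cases "g u = 0 \<or> ?d x \<notin> T")
        case True
        then have "E2 x = 0"
        proof
          assume "?d x \<notin> T"
          moreover have "horizontal_sq \<sigma> (?d x) \<le> horizontal_sq \<sigma> x"
            unfolding horizontal_sq_def
          proof (rule sum_mono)
            fix k assume k: "k \<in> ?F"
            have "\<bar>x $ k / R\<bar> \<le> \<bar>x $ k\<bar>" using R(1) by (simp add: divide_le_eq mult_le_cancel_left1)
            then have "(x $ k / R)\<^sup>2 \<le> (x $ k)\<^sup>2" by (simp only: abs_le_square_iff)
            then show "(?d x $ k)\<^sup>2 \<le> (x $ k)\<^sup>2"
              using k by (simp add: d_nth first_stratum_def)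
          qed
          ultimately consider "exp (2 * (real m + 1)) < u" | j where "j \<in> - ?F" "2 < \<bar>?d x $ j\<bar>"
            unfolding T_def u_def by fastforce
          then show "E2 x = 0"
          proof cases
            case 1
            then have "g u = 0" by (intro g(6)) auto
            then show ?thesis by (simp add: E2_def u_def)
          next
            case 2
            then show ?thesis by (simp add: E2_def DP_far)
          qed
        qed (simp add: E2_def u_def)
        then show ?thesis by (simp add: w_def i3_def)
      next
        case False
        then have gu: "g u \<noteq> 0" and dT: "?d x \<in> T" by auto
        have u2: "exp (-2) < u" "u < exp (2 * (real m + 1))" using gu g(6)[of u] by (meson not_le)+
        have "exp (2 * (real m + 1)) \<le> exp (2 * (real m + 2))" by simp
        with u2(2) have "u < exp (2 * (real m + 2))" by (rule less_le_trans)
        then have "x \<in> shell \<sigma> (- 1) (real m + 2) (2 * R)" unfolding mem using u2 by auto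
        then have i3: "i3 = 1" by (simp add: i3_def)
        have xk: "\<bar>x $ k\<bar> \<le> exp (real m + 1)" if "k \<in> ?F" for k
        proof -
          have "(x $ k)\<^sup>2 \<le> u"
            unfolding u_def horizontal_sq_def using that member_le_sum[of k ?F "\<lambda>k. (x $ k)\<^sup>2"] by simp
          also have "u \<le> (exp (real m + 1))\<^sup>2" using u2(2) exp_double[of "real m + 1"] by linarith
          finally show ?thesis by (simp add: abs_le_square_iff[symmetric])
        qed
        have lin: "linear (?DP (?d x))" using DP has_derivative_linear by blast
        have "\<bar>?DP (?d x) (radial_field \<sigma> X (?d x))\<bar> = \<bar>\<Sum>k\<in>?F. (?d x $ k) * ?DP (?d x) (X k (?d x))\<bar>"
          by (simp add: radial_field_def linear_sum[OF lin] linear_cmul[OF lin])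
        also have "\<dots> \<le> (\<Sum>k\<in>?F. \<bar>?d x $ k\<bar> * \<bar>?DP (?d x) (X k (?d x))\<bar>)"
          by (rule order_trans[OF sum_abs]) (simp add: abs_mult)
        also have "\<dots> \<le> (\<Sum>k\<in>?F. exp (real m + 1) / R * \<bar>?DP (?d x) (X k (?d x))\<bar>)"
        proof (intro sum_mono mult_right_mono)
          fix k assume "k \<in> ?F"
          then show "\<bar>?d x $ k\<bar> \<le> exp (real m + 1) / R"
            using xk[of k] R(1) by (simp add: d_nth first_stratum_def divide_right_mono)
        qed simp
        also have "\<dots> = exp (real m + 1) / R * \<Theta> (?d x)" by (simp add: \<Theta>_def sum_distrib_left)
        also have "\<dots> \<le> exp (real m + 1) / R * M" using M[OF dT] R(1) by (intro mult_left_mono) auto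
        also have "\<dots> \<le> 1 / real m" using R m by (simp add: field_simps)
        finally have "\<bar>?DP (?d x) (radial_field \<sigma> X (?d x))\<bar> \<le> 1 / real m" .
        moreover have "\<bar>g u\<bar> \<le> w" using g(3,4)[OF u] by (simp add: w_def)
        ultimately have "\<bar>E2 x\<bar> \<le> w * (1 / real m)"
          unfolding E2_def abs_mult u_def[symmetric] by (intro mult_mono) auto
        then show ?thesis by (simp add: i3)
      qed
      have w0: "0 \<le> w" by (simp add: w_def)
      have i: "i1 = 0 \<or> i1 = 1" "i2 = 0 \<or> i2 = 1" "i3 = 0 \<or> i3 = 1" by (auto simp: i1_def i2_def i3_def indicator_def)
      define y where "y = max (K0 * max i1 i2) (1 / real m * i3)"
      have "\<bar>E1 x + E2 x\<bar> \<le> K0 * w * max i1 i2 + 1 / real m * w * i3"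
        using e1 e2 by linarith
      also have "\<dots> = w * (K0 * max i1 i2 + 1 / real m * i3)" by (simp add: algebra_simps)
      also have "\<dots> \<le> w * (3 * y)"
      proof (intro mult_left_mono w0)
        have "0 \<le> y" using i K0 by (auto simp: y_def max_def)
        then show "K0 * max i1 i2 + 1 / real m * i3 \<le> 3 * y" unfolding y_def by linarith
      qed
      finally have "\<bar>E1 x + E2 x\<bar> powr p \<le> (w * (3 * y)) powr p" using p by (intro powr_mono2) auto
      also have "\<dots> = w powr p * (3 powr p * y powr p)"
        using w0 i K0 by (simp add: powr_mult y_def)
      also have "\<dots> \<le> w powr p * ?r"
      proof (rule mult_left_mono)
        \<comment> \<open>Order 1 / m suffices, because the region where \<open>i3\<close> is 1
          consists of at most m + 3 unit shells.\<close>
        have mp: "(1 / real m) powr p \<le> 1 / real m"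
          using powr_mono'[of 1 p "1 / real m"] p m by simp
        have "y powr p \<le> K0 powr p * i1 + K0 powr p * i2 + 1 / real m * i3"
          unfolding y_def using i mp p K0 by (auto simp: max_def powr_mult intro: add_increasing)
        also have "\<dots> \<le> (K0 powr p + 1) * i1 + (K0 powr p + 1) * i2 + (K0 powr p + 1) / real m * i3"
          using i by (intro add_mono mult_right_mono divide_right_mono) auto
        finally have "3 powr p * y powr p \<le> 3 powr p * ((K0 powr p + 1) * i1 + (K0 powr p + 1) * i2 + (K0 powr p + 1) / real m * i3)"
          by (rule mult_left_mono) simp
        then show "3 powr p * y powr p \<le> ?r"
          unfolding K_def i1_def[symmetric] i2_def[symmetric] i3_def[symmetric] by (simp add: algebra_simps)
      qed simp
      finally have "\<bar>E1 x + E2 x\<bar> powr p \<le> w powr p * ?r" .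
      then have "?l \<le> w powr p * ?r * u powr (- \<alpha> * p / 2)"
        unfolding u_def by (rule mult_right_mono) simp
      also have "\<dots> = w powr p * u powr (- \<alpha> * p / 2) * ?r" by (simp only: mult_ac)
      also have "w powr p * u powr (- \<alpha> * p / 2) = u powr (- l / 2 * p + - \<alpha> * p / 2)"
        by (simp only: w_def powr_powr powr_add)
      also have "- l / 2 * p + - \<alpha> * p / 2 = - real (card ?F) / 2"
        using p by (simp add: l_def field_simps)
      finally show ?thesis by (simp only: shell_weight_def u_def)
    qed
    ultimately show "\<exists>F E R. 0 < R \<and> (\<lambda>x. complex_of_real (F x)) \<in> test_functions (horizontal_nonzero \<sigma>) \<and>
      (\<forall>x. indicator (shell \<sigma> 0 (real m) R) x * shell_weight \<sigma> x
           \<le> \<bar>F x\<bar> powr p * horizontal_sq \<sigma> x powr (- \<alpha> * p / 2)) \<and>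
      (\<forall>x. horizontal_radial \<sigma> X (\<lambda>x. complex_of_real (F x)) x = complex_of_real (- l * F x + E x)) \<and>
      (\<forall>x. \<bar>E x\<bar> powr p * horizontal_sq \<sigma> x powr (- \<alpha> * p / 2) \<le> shell_weight \<sigma> x *
         (K * indicator (shell \<sigma> (- 2) 1 (2 * R)) x + K * indicator (shell \<sigma> (real m - 1) (real m + 2) (2 * R)) x
          + K / real m * indicator (shell \<sigma> (- 1) (real m + 2) (2 * R)) x))"
      using R(1) by (intro exI[of _ F] exI[of _ "\<lambda>x. E1 x + E2 x"] exI[of _ R]) auto
  qed
qed

text \<open>Tested on the near extremal functions, the constant \<open>C\<close> would give (C powr
  p - B) m A at most a constant times A, where \<open>B < C powr p\<close> and \<open>A\<close> is
  the mass of one unit shell. After division by A the right side depends on neither m nor R, so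
  large m contradict it.\<close>

lemma hardy_constant_sharp:
  assumes p: "1 < p" and C: "\<bar>real (card (first_stratum \<sigma>)) - \<alpha> * p\<bar> / p < C"
    and all: "\<And>f. f \<in> test_functions (horizontal_nonzero \<sigma>) \<Longrightarrow>
      C powr p * (\<integral>x. cmod (f x) powr p * horizontal_sq \<sigma> x powr (- \<alpha> * p / 2) \<partial>lborel)
      \<le> (\<integral>x. cmod (horizontal_radial \<sigma> X f x) powr p * horizontal_sq \<sigma> x powr (- \<alpha> * p / 2) \<partial>lborel)"
  shows False
proof -
  define l where "l = (real (card (first_stratum \<sigma>)) - \<alpha> * p) / p"
  define v where "v x = horizontal_sq \<sigma> x powr (- \<alpha> * p / 2)" for x
  define Q where "Q = (\<Sum>j\<in>- first_stratum \<sigma>. \<sigma> j)"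
  have v0: "0 \<le> v x" for x by (simp add: v_def)
  have "\<bar>l\<bar> < C" using C p by (simp add: l_def)
  then have "\<bar>l\<bar> powr p < C powr p" using p by (intro powr_less_mono2) auto
  \<comment> \<open>Since C powr p exceeds |l| powr p strictly, there is room for the loss of
    \<open>add_powr_le_split\<close> on the main term. The parameter is fixed before
    \<open>m\<close>, so the factor \<open>H\<close> on the errors stays a constant.\<close>
  then obtain \<tau> where \<tau>: "0 < \<tau>" "\<tau> < 1" "(1 - \<tau>) powr (1 - p) * \<bar>l\<bar> powr p < C powr p"
    using split_constant_exists[of "\<bar>l\<bar> powr p" "C powr p" p] by auto
  define B where "B = (1 - \<tau>) powr (1 - p) * \<bar>l\<bar> powr p"
  define H where "H = \<tau> powr (1 - p)"
  have H0: "0 \<le> H" by (simp add: H_def)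
  obtain K where K: "0 \<le> K" and ex: "\<And>m. 1 \<le> m \<Longrightarrow> \<exists>F E R. 0 < R \<and> (\<lambda>x. complex_of_real (F x)) \<in> test_functions (horizontal_nonzero \<sigma>) \<and>
      (\<forall>x. indicator (shell \<sigma> 0 (real m) R) x * shell_weight \<sigma> x
           \<le> \<bar>F x\<bar> powr p * horizontal_sq \<sigma> x powr (- \<alpha> * p / 2)) \<and>
      (\<forall>x. horizontal_radial \<sigma> X (\<lambda>x. complex_of_real (F x)) x = complex_of_real (- l * F x + E x)) \<and>
      (\<forall>x. \<bar>E x\<bar> powr p * horizontal_sq \<sigma> x powr (- \<alpha> * p / 2) \<le> shell_weight \<sigma> x *
         (K * indicator (shell \<sigma> (- 2) 1 (2 * R)) x + K * indicator (shell \<sigma> (real m - 1) (real m + 2) (2 * R)) x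
          + K / real m * indicator (shell \<sigma> (- 1) (real m + 2) (2 * R)) x))"
    unfolding l_def by (rule near_extremal_exists[OF p, of \<alpha>]) blast
  have main: "(C powr p - B) * real m \<le> H * (2 ^ Q * (10 * K))" if m: "1 \<le> m" for m
  proof -
    obtain F E R where R: "0 < R" and tf: "(\<lambda>x. complex_of_real (F x)) \<in> test_functions (horizontal_nonzero \<sigma>)"
      and low: "\<And>x. indicator (shell \<sigma> 0 (real m) R) x * shell_weight \<sigma> x \<le> \<bar>F x\<bar> powr p * v x"
      and rad: "\<And>x. horizontal_radial \<sigma> X (\<lambda>x. complex_of_real (F x)) x = complex_of_real (- l * F x + E x)"
      and err: "\<And>x. \<bar>E x\<bar> powr p * v x \<le> shell_weight \<sigma> x *
         (K * indicator (shell \<sigma> (- 2) 1 (2 * R)) x + K * indicator (shell \<sigma> (real m - 1) (real m + 2) (2 * R)) x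
          + K / real m * indicator (shell \<sigma> (- 1) (real m + 2) (2 * R)) x)"
      using ex[OF m] unfolding v_def by blast
    note T = test_function_facts[OF tf]
    let ?w = "shell_weight \<sigma>"
    obtain A where A: "0 < A"
      "\<And>a m. integrable lborel (\<lambda>x. ?w x * indicator (shell \<sigma> a (a + real m) R) x)"
      "\<And>a m. (\<integral>x. ?w x * indicator (shell \<sigma> a (a + real m) R) x \<partial>lborel) = real m * A"
      "\<And>a m. integrable lborel (\<lambda>x. ?w x * indicator (shell \<sigma> a (a + real m) (2 * R)) x)"
      "\<And>a m. (\<integral>x. ?w x * indicator (shell \<sigma> a (a + real m) (2 * R)) x \<partial>lborel) = 2 ^ Q * (real m * A)"
      using shell_integral[OF R first_stratum_nonempty] unfolding Q_def by blast
    define I where "I = (\<integral>x. \<bar>F x\<bar> powr p * v x \<partial>lborel)"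
    have I_int: "integrable lborel (\<lambda>x. \<bar>F x\<bar> powr p * v x)"
      using weighted_nn_integral(1)[OF T(1,2,6,3), of p \<alpha>] p by (simp add: v_def)
    have J_int: "integrable lborel (\<lambda>x. \<bar>- l * F x + E x\<bar> powr p * v x)"
      using weighted_nn_integral(1)[OF T(1,2,8,9), of p \<alpha>] p unfolding rad v_def norm_of_real by simp
    have "real m * A = (\<integral>x. ?w x * indicator (shell \<sigma> 0 (real m) R) x \<partial>lborel)"
      using A(3)[of 0 m] by simp
    also have "\<dots> \<le> I"
      unfolding I_def using A(2)[of 0 m] low I_int by (intro integral_mono) (auto simp: mult.commute)
    finally have I_low: "real m * A \<le> I" .
    define S where "S x = ?w x * indicator (shell \<sigma> (- 2) 1 (2 * R)) x * K
        + ?w x * indicator (shell \<sigma> (real m - 1) (real m + 2) (2 * R)) x * K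
        + ?w x * indicator (shell \<sigma> (- 1) (real m + 2) (2 * R)) x * (K / real m)" for x
    have i1: "integrable lborel (\<lambda>x. ?w x * indicator (shell \<sigma> (- 2) 1 (2 * R)) x)"
      "(\<integral>x. ?w x * indicator (shell \<sigma> (- 2) 1 (2 * R)) x \<partial>lborel) = 2 ^ Q * (3 * A)"
      using A(4)[of "-2" 3] A(5)[of "-2" 3] by simp_all
    have i2: "integrable lborel (\<lambda>x. ?w x * indicator (shell \<sigma> (real m - 1) (real m + 2) (2 * R)) x)"
      "(\<integral>x. ?w x * indicator (shell \<sigma> (real m - 1) (real m + 2) (2 * R)) x \<partial>lborel) = 2 ^ Q * (3 * A)"
      using A(4)[of "real m - 1" 3] A(5)[of "real m - 1" 3] by (simp_all add: add.commute)
    have "- 1 + real (m + 3) = real m + 2" by simp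
    then have i3: "integrable lborel (\<lambda>x. ?w x * indicator (shell \<sigma> (- 1) (real m + 2) (2 * R)) x)"
      "(\<integral>x. ?w x * indicator (shell \<sigma> (- 1) (real m + 2) (2 * R)) x \<partial>lborel) = 2 ^ Q * ((real m + 3) * A)"
      using A(4)[of "-1" "m + 3"] A(5)[of "-1" "m + 3"] by (simp_all add: add.commute)
    have S_int: "integrable lborel S" "(\<integral>x. S x \<partial>lborel) = 2 ^ Q * (3 * A) * K + 2 ^ Q * (3 * A) * K + 2 ^ Q * ((real m + 3) * A) * (K / real m)"
      unfolding S_def[abs_def] using i1 i2 i3 by simp_all
    \<comment> \<open>For m \<ge> 1 the quotient (m + 3) / m is at most 4. Together with 3 unit
      shells for each of the two layers this makes the 10 in the bound.\<close>
    define t where "t = (real m + 3) * (K / real m)"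
    have "t \<le> 4 * K"
      using m K by (simp add: t_def field_simps mult_left_mono)
    then have "2 ^ Q * A * t \<le> 2 ^ Q * A * (4 * K)"
      using A(1) by (intro mult_left_mono) auto
    moreover have "2 ^ Q * ((real m + 3) * A) * (K / real m) = 2 ^ Q * A * t"
      unfolding t_def by (simp only: mult_ac)
    ultimately have S_le: "(\<integral>x. S x \<partial>lborel) \<le> 2 ^ Q * (10 * K) * A"
      unfolding S_int(2) by (simp add: algebra_simps)
    have "C powr p * I \<le> (\<integral>x. \<bar>- l * F x + E x\<bar> powr p * v x \<partial>lborel)"
      using all[OF tf] unfolding rad norm_of_real I_def v_def .
    also have "\<dots> \<le> (\<integral>x. B * (\<bar>F x\<bar> powr p * v x) + H * S x \<partial>lborel)"
    proof (rule integral_mono)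
      show "integrable lborel (\<lambda>x. \<bar>- l * F x + E x\<bar> powr p * v x)" by (rule J_int)
      show "integrable lborel (\<lambda>x. B * (\<bar>F x\<bar> powr p * v x) + H * S x)" using I_int S_int by simp
      fix x
      have "\<bar>- l * F x + E x\<bar> powr p \<le> (\<bar>l * F x\<bar> + \<bar>E x\<bar>) powr p"
        using p by (intro powr_mono2) auto
      also have "\<dots> \<le> (1 - \<tau>) powr (1 - p) * \<bar>l * F x\<bar> powr p + H * \<bar>E x\<bar> powr p"
        unfolding H_def using p \<tau> by (intro add_powr_le_split) auto
      also have "\<dots> = B * \<bar>F x\<bar> powr p + H * \<bar>E x\<bar> powr p"
        by (simp add: B_def abs_mult powr_mult)
      finally have "\<bar>- l * F x + E x\<bar> powr p * v x \<le> (B * \<bar>F x\<bar> powr p + H * \<bar>E x\<bar> powr p) * v x"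
        using v0 by (rule mult_right_mono)
      also have "\<dots> = B * (\<bar>F x\<bar> powr p * v x) + H * (\<bar>E x\<bar> powr p * v x)" by (simp add: algebra_simps)
      also have "\<dots> \<le> B * (\<bar>F x\<bar> powr p * v x) + H * S x"
        using err[of x] H0 by (intro add_left_mono mult_left_mono) (auto simp: S_def algebra_simps)
      finally show "\<bar>- l * F x + E x\<bar> powr p * v x \<le> B * (\<bar>F x\<bar> powr p * v x) + H * S x" .
    qed
    also have "\<dots> = B * I + H * (\<integral>x. S x \<partial>lborel)"
      using I_int S_int(1) by (simp add: I_def)
    finally have "(C powr p - B) * I \<le> H * (\<integral>x. S x \<partial>lborel)" by (simp add: algebra_simps)
    moreover have "(C powr p - B) * (real m * A) \<le> (C powr p - B) * I"
      using I_low \<tau>(3) by (intro mult_left_mono) (auto simp: B_def)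
    moreover have "H * (\<integral>x. S x \<partial>lborel) \<le> H * (2 ^ Q * (10 * K) * A)"
      using S_le H0 by (rule mult_left_mono)
    ultimately have "((C powr p - B) * real m) * A \<le> (H * (2 ^ Q * (10 * K))) * A" by (simp add: mult.assoc)
    then show ?thesis using A(1) by simp
  qed
  have "0 < C powr p - B" using \<tau>(3) by (simp add: B_def)
  then obtain m :: nat where "H * (2 ^ Q * (10 * K)) < real m * (C powr p - B)"
    using ex_less_of_nat_mult by blast
  moreover have "0 \<le> H * (2 ^ Q * (10 * K))" using H0 K by simp
  ultimately have "1 \<le> m" by (cases m) auto
  with \<open>H * (2 ^ Q * (10 * K)) < real m * (C powr p - B)\<close> show False using main[of m] by (simp add: mult.commute)
qed

lemma Lp_norm_horizontal_iff:
  assumes "f \<in> test_functions (horizontal_nonzero \<sigma>)" "1 < p" "0 \<le> C"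
  shows "ennreal C * Lp_norm p (\<lambda>x. f x / of_real (horizontal_norm \<sigma> x powr \<alpha>))
       \<le> Lp_norm p (\<lambda>x. horizontal_radial \<sigma> X f x / of_real (horizontal_norm \<sigma> x powr \<alpha>)) \<longleftrightarrow>
    C powr p * (\<integral>x. cmod (f x) powr p * horizontal_sq \<sigma> x powr (- \<alpha> * p / 2) \<partial>lborel)
       \<le> (\<integral>x. cmod (horizontal_radial \<sigma> X f x) powr p * horizontal_sq \<sigma> x powr (- \<alpha> * p / 2) \<partial>lborel)"
proof -
  note T = test_function_facts[OF assms(1)]
  show ?thesis
    using assms(2,3) weighted_nn_integral(2)[OF T(1,2,6,3), of p \<alpha>] weighted_nn_integral(2)[OF T(1,2,8,9), of p \<alpha>]
    by (intro Lp_norm_cmult_le_iff) auto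
qed

end

theorem theorem3p1:
  fixes G :: "(real^'n) monoid" and \<sigma> :: "'n \<Rightarrow> nat" and X :: "'n \<Rightarrow> real^'n \<Rightarrow> real^'n"
    and \<alpha> p :: real and N :: nat
  assumes "stratified_group G \<sigma> X"
    and "N = card (first_stratum \<sigma>)"
    and "1 < p"
  shows "(\<forall>f \<in> test_functions (horizontal_nonzero \<sigma>).
            ennreal (\<bar>real N - \<alpha> * p\<bar> / p) *
              Lp_norm p (\<lambda>x. f x / of_real (horizontal_norm \<sigma> x powr \<alpha>))
            \<le> Lp_norm p (\<lambda>x. horizontal_radial \<sigma> X f x / of_real (horizontal_norm \<sigma> x powr \<alpha>))) \<and>
         (real N \<noteq> \<alpha> * p \<longrightarrow>
            (\<forall>C > \<bar>real N - \<alpha> * p\<bar> / p.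
               \<not> (\<forall>f \<in> test_functions (horizontal_nonzero \<sigma>).
                    ennreal C * Lp_norm p (\<lambda>x. f x / of_real (horizontal_norm \<sigma> x powr \<alpha>))
                    \<le> Lp_norm p (\<lambda>x. horizontal_radial \<sigma> X f x /
                                       of_real (horizontal_norm \<sigma> x powr \<alpha>)))))"
proof -
  interpret stratified_group G \<sigma> X by fact
  have nn: "0 \<le> \<bar>real N - \<alpha> * p\<bar> / p" using assms(3) by simp
  show ?thesis
  proof (intro conjI ballI impI allI notI)
    fix f assume f: "f \<in> test_functions (horizontal_nonzero \<sigma>)"
    show "ennreal (\<bar>real N - \<alpha> * p\<bar> / p) * Lp_norm p (\<lambda>x. f x / of_real (horizontal_norm \<sigma> x powr \<alpha>))
            \<le> Lp_norm p (\<lambda>x. horizontal_radial \<sigma> X f x / of_real (horizontal_norm \<sigma> x powr \<alpha>))"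
      unfolding Lp_norm_horizontal_iff[OF f assms(3) nn]
      using hardy_integral_inequality[OF f assms(3)] assms(2) by simp
  next
    fix C assume C: "\<bar>real N - \<alpha> * p\<bar> / p < C" and all: "\<forall>f \<in> test_functions (horizontal_nonzero \<sigma>).
        ennreal C * Lp_norm p (\<lambda>x. f x / of_real (horizontal_norm \<sigma> x powr \<alpha>))
        \<le> Lp_norm p (\<lambda>x. horizontal_radial \<sigma> X f x / of_real (horizontal_norm \<sigma> x powr \<alpha>))"
    have "0 \<le> C" using C nn by linarith
    then show False
      using hardy_constant_sharp[OF assms(3) C[unfolded assms(2)]] all Lp_norm_horizontal_iff[OF _ assms(3)]
      by blast
  qed
qed

end
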